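(* Let $C$ be a cocommutative $k$-coalgebra and $\{\Psi_n:C\longrightarrow Vect_k(\mathscr O(n),\mathscr O'(n))\}_{n\ge0}$ a measuring of non-$\Sigma$ operads with multiplication. Let $\mathscr L$ and $\mathscr L'$ be cyclic unital comp modules over $\mathscr O$ and $\mathscr O'$ respectively. Given a $(C,\{\Psi_n\}_{n\ge0})$-comodule measuring $\{\Omega_n:D\longrightarrow Vect_k(\mathscr L(n),\mathscr L'(n))\}_{n\ge0}$ from $\mathscr L$ to $\mathscr L'$, each $y\in D$ induces (through the maps $\Omega_n(y)$) a morphism $\underline\Omega^{cy}_\bullet(y):HC_\bullet(\mathscr O,\mathscr L)\longrightarrow HC_\bullet(\mathscr O',\mathscr L')$ on cyclic homologies.
   Context: $k$ is a field; $Vect_k(V,W)$ denotes $k$-linear maps; Sweedler notation with summation suppressed. A non-$\Sigma$ operad $(\mathscr O,m,e)$ over $k$ with multiplication consists of vector spaces $\{\mathscr O(n)\}_{n\ge0}$, bilinear operations $\circ_i:\mathscr O(p)\otimes\mathscr O(q)\to\mathscr O(p+q-1)$ and an identity $\mathbf 1\in\mathscr O(1)$ such that for $u\in\mathscr O(p)$, $v\in\mathscr O(q)$, $w\in\mathscr O(r)$: $u\circ_iv=0$ if $p<i$ or $p=0$; $(u\circ_iv)\circ_jw$ equals $(u\circ_jw)\circ_{i+r-1}v$ if $j<i$, $u\circ_i(v\circ_{j-i+1}w)$ if $i\le j<q+i$, and $(u\circ_{j-q+1}w)\circ_iv$ if $j\ge q+i$; $u\circ_i\mathbf 1=\mathbf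 1\circ_1u=u$ for $i\le p$; together with $m\in\mathscr O(2)$, $e\in\mathscr O(0)$ satisfying $m\circ_1m=m\circ_2m$ and $m\circ_1e=m\circ_2e=\mathbf 1$. A $C$-measuring from $(\mathscr O,m,e)$ to $(\mathscr O',m',e')$, with $C$ a cocommutative $k$-coalgebra with counit $\epsilon_C$, is a family of linear maps $\{\Psi_n:C\to Vect_k(\mathscr O(n),\mathscr O'(n))\}_{n\ge0}$ such that $\Psi_{p+q-1}(x)(u\circ_iv)=\Psi_p(x_{(1)})(u)\circ'_i\Psi_q(x_{(2)})(v)$, $\Psi_2(x)(m)=\epsilon_C(x)m'$, $\Psi_0(x)(e)=\epsilon_C(x)e'$ for all $x\in C$, $u\in\mathscr O(p)$, $v\in\mathscr O(q)$. A cyclic unital (left) comp module $\mathscr L$ over $(\mathscr O,m,e)$ consists of vector spaces $\{\mathscr L(n)\}_{n\ge0}$; bilinear operations $\bullet_i:\mathscr O(p)\otimes\mathscr L(n)\to\mathscr L(n-p+1)$, $0\le i\le n+1-p$, set to be zero for $p>n+1$, such that for $u\in\mathscr O(p)$, $v\in\mathscr O(q)$, $l\in\mathscr L(n)$: if $p>0$, $u\bullet_i(v\bullet_jl)$ equals $v\bullet_j(u\bullet_{i+q-1}l)$ if $j<i$, $(u\circ_{j-i+1}v)\bullet_il$ if $j-p<i\le j$, and $v\bullet_{j-p+1}(u\bullet_il)$ if $0\le i\le j-p$; if $p=0$, $u\bullet_i(v\bullet_jl)$ equals $v\bullet_j(u\bullet_{i+q-1}l)$ if $j<i$ and $v\bullet_{j+1}(u\bullet_il)$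 if $0\le i\le j$; $\mathbf 1\bullet_il=l$ for $i=0,\dots,n$; and cyclic operators $t:\mathscr L(n)\to\mathscr L(n)$ ($n\ge1$; $t=\mathrm{id}$ on $\mathscr L(0)$) with $t(u\bullet_il)=u\bullet_{i+1}t(l)$ for $0\le i\le n-p$ and $t^{n+1}=\mathrm{id}$ on $\mathscr L(n)$. A $(C,\{\Psi_n\})$-comodule measuring from $\mathscr L$ to $\mathscr L'$ is a left $C$-comodule $D$ (coaction $y\mapsto y_{(0)}\otimes y_{(1)}\in C\otimes D$) and linear maps $\{\Omega_n:D\to Vect_k(\mathscr L(n),\mathscr L'(n))\}_{n\ge0}$ such that $\Omega_{n-p+1}(y)(u\bullet_il)=\Psi_p(y_{(0)})(u)\bullet_i\Omega_n(y_{(1)})(l)$ for $u\in\mathscr O(p)$, $l\in\mathscr L(n)$, $0\le i\le n+1-p$, and $\Omega_n(y)(t(l))=t'(\Omega_n(y)(l))$. $HC_\bullet(\mathscr O,\mathscr L)$ is the cyclic homology of the cyclic module with $n$-th term $\mathscr L(n)$, cyclic operator $t$, face maps $d_i(l)=m\bullet_il$ for $0\le i<n$, $d_n(l)=m\bullet_0t(l)$, and degeneracies $s_j(l)=e\bullet_{j+1}l$ for $0\le j\le n$ ($l\in\mathscr L(n)$). *)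

theory Defs
  imports "HOL-Algebra.Module" "HOL-Algebra.AbelCoset"
begin

section \<open>Vector spaces, linear maps, quotients and tensor products\<close>

text \<open>
  A \<open>K\<close>-vector space is a \<^locale>\<open>module\<close> over a \<^locale>\<open>field\<close>.  The ring
  multiplication of a record of type \<^type>\<open>module\<close> plays no role and is left unspecified
  in the constructions below.
\<close>

definition linear_map ::
    "('k, 'r) ring_scheme \<Rightarrow> ('k, 'v, 'm) module_scheme \<Rightarrow> ('k, 'w, 'n) module_scheme \<Rightarrow> ('v \<Rightarrow> 'w) \<Rightarrow> bool"
  where "linear_map K V W f \<longleftrightarrow>
    f \<in> carrier V \<rightarrow> carrier W \<and>
    (\<forall>x\<in>carrier V. \<forall>y\<in>carrier V. f (x \<oplus>\<^bsub>V\<^esub> y) = f x \<oplus>\<^bsub>W\<^esub> f y) \<and>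
    (\<forall>a\<in>carrier K. \<forall>x\<in>carrier V. f (a \<odot>\<^bsub>V\<^esub> x) = a \<odot>\<^bsub>W\<^esub> f x)"

definition bilinear_map ::
    "('k, 'r) ring_scheme \<Rightarrow> ('k, 'u, 'l) module_scheme \<Rightarrow> ('k, 'v, 'm) module_scheme
      \<Rightarrow> ('k, 'w, 'n) module_scheme \<Rightarrow> ('u \<Rightarrow> 'v \<Rightarrow> 'w) \<Rightarrow> bool"
  where "bilinear_map K U V W B \<longleftrightarrow>
    (\<forall>u\<in>carrier U. linear_map K V W (B u)) \<and>
    (\<forall>v\<in>carrier V. linear_map K U W (\<lambda>u. B u v))"

definition base_space :: "('k, 'r) ring_scheme \<Rightarrow> ('k, 'k) module"
  where "base_space K =
    \<lparr>carrier = carrier K, mult = mult K, one = one K, zero = zero K, add = add K, smult = mult K\<rparr>"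

definition vspan :: "('k, 'r) ring_scheme \<Rightarrow> ('k, 'v, 'm) module_scheme \<Rightarrow> 'v set \<Rightarrow> 'v set"
  where "vspan K V A = \<Inter> {N. submodule N K V \<and> A \<subseteq> N}"

definition quotient_space :: "('k, 'v, 'm) module_scheme \<Rightarrow> 'v set \<Rightarrow> ('k, 'v set) module"
  where "quotient_space V N =
    \<lparr>carrier = a_rcosets\<^bsub>V\<^esub> N, mult = undefined, one = undefined,
     zero = N, add = (\<lambda>X Y. X <+>\<^bsub>V\<^esub> Y),
     smult = (\<lambda>a X. \<Union>x\<in>X. N +>\<^bsub>V\<^esub> (a \<odot>\<^bsub>V\<^esub> x))\<rparr>"

definition free_space :: "('k, 'r) ring_scheme \<Rightarrow> 's set \<Rightarrow> ('k, 's \<Rightarrow> 'k) module"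
  where "free_space K S =
    \<lparr>carrier = {f \<in> S \<rightarrow>\<^sub>E carrier K. finite {s \<in> S. f s \<noteq> \<zero>\<^bsub>K\<^esub>}},
     mult = undefined, one = undefined,
     zero = (\<lambda>s\<in>S. \<zero>\<^bsub>K\<^esub>), add = (\<lambda>f g. \<lambda>s\<in>S. f s \<oplus>\<^bsub>K\<^esub> g s),
     smult = (\<lambda>a f. \<lambda>s\<in>S. a \<otimes>\<^bsub>K\<^esub> f s)\<rparr>"

definition free_gen :: "('k, 'r) ring_scheme \<Rightarrow> 's set \<Rightarrow> 's \<Rightarrow> 's \<Rightarrow> 'k"
  where "free_gen K S s = (\<lambda>s'\<in>S. if s' = s then \<one>\<^bsub>K\<^esub> else \<zero>\<^bsub>K\<^esub>)"

definition tensor_relations ::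
    "('k, 'r) ring_scheme \<Rightarrow> ('k, 'v, 'm) module_scheme \<Rightarrow> ('k, 'w, 'n) module_scheme \<Rightarrow> ('v \<times> 'w \<Rightarrow> 'k) set"
  where "tensor_relations K V W =
   (let F = free_space K (carrier V \<times> carrier W); g = free_gen K (carrier V \<times> carrier W) in
     {g (x \<oplus>\<^bsub>V\<^esub> x', y) \<ominus>\<^bsub>F\<^esub> (g (x, y) \<oplus>\<^bsub>F\<^esub> g (x', y)) | x x' y.
        x \<in> carrier V \<and> x' \<in> carrier V \<and> y \<in> carrier W} \<union>
     {g (x, y \<oplus>\<^bsub>W\<^esub> y') \<ominus>\<^bsub>F\<^esub> (g (x, y) \<oplus>\<^bsub>F\<^esub> g (x, y')) | x y y'.
        x \<in> carrier V \<and> y \<in> carrier W \<and> y' \<in> carrier W} \<union>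
     {g (a \<odot>\<^bsub>V\<^esub> x, y) \<ominus>\<^bsub>F\<^esub> (a \<odot>\<^bsub>F\<^esub> g (x, y)) | a x y.
        a \<in> carrier K \<and> x \<in> carrier V \<and> y \<in> carrier W} \<union>
     {g (x, a \<odot>\<^bsub>W\<^esub> y) \<ominus>\<^bsub>F\<^esub> (a \<odot>\<^bsub>F\<^esub> g (x, y)) | a x y.
        a \<in> carrier K \<and> x \<in> carrier V \<and> y \<in> carrier W})"

definition tensor_null ::
    "('k, 'r) ring_scheme \<Rightarrow> ('k, 'v, 'm) module_scheme \<Rightarrow> ('k, 'w, 'n) module_scheme \<Rightarrow> ('v \<times> 'w \<Rightarrow> 'k) set"
  where "tensor_null K V W =
    vspan K (free_space K (carrier V \<times> carrier W)) (tensor_relations K V W)"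

definition tensor ::
    "('k, 'r) ring_scheme \<Rightarrow> ('k, 'v, 'm) module_scheme \<Rightarrow> ('k, 'w, 'n) module_scheme
      \<Rightarrow> ('k, ('v \<times> 'w \<Rightarrow> 'k) set) module"
  where "tensor K V W =
    quotient_space (free_space K (carrier V \<times> carrier W)) (tensor_null K V W)"

definition pure_tensor ::
    "('k, 'r) ring_scheme \<Rightarrow> ('k, 'v, 'm) module_scheme \<Rightarrow> ('k, 'w, 'n) module_scheme
      \<Rightarrow> 'v \<Rightarrow> 'w \<Rightarrow> ('v \<times> 'w \<Rightarrow> 'k) set"
  where "pure_tensor K V W x y =
    tensor_null K V W +>\<^bsub>free_space K (carrier V \<times> carrier W)\<^esub> free_gen K (carrier V \<times> carrier W) (x, y)"

text \<open>
  The linear map \<open>V \<otimes> W \<rightarrow> X\<close> induced by a bilinear map \<open>B : V \<times> W \<rightarrow> X\<close>.  This is what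
  Sweedler notation with suppressed summation stands for: if \<open>\<delta> x = x\<^sub>(\<^sub>1\<^sub>) \<otimes> x\<^sub>(\<^sub>2\<^sub>)\<close>, then the
  expression \<open>B x\<^sub>(\<^sub>1\<^sub>) x\<^sub>(\<^sub>2\<^sub>)\<close> is \<open>tensor_lift K V W X B (\<delta> x)\<close>.
\<close>

definition tensor_lift ::
    "('k, 'r) ring_scheme \<Rightarrow> ('k, 'v, 'm) module_scheme \<Rightarrow> ('k, 'w, 'n) module_scheme
      \<Rightarrow> ('k, 'x, 'l) module_scheme \<Rightarrow> ('v \<Rightarrow> 'w \<Rightarrow> 'x) \<Rightarrow> ('v \<times> 'w \<Rightarrow> 'k) set \<Rightarrow> 'x"
  where "tensor_lift K V W X B =
    (THE f. f \<in> extensional (carrier (tensor K V W)) \<and> linear_map K (tensor K V W) X f \<and>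
       (\<forall>x\<in>carrier V. \<forall>y\<in>carrier W. f (pure_tensor K V W x y) = B x y))"

definition tensor_map ::
    "('k, 'r) ring_scheme \<Rightarrow> ('k, 'v, 'm) module_scheme \<Rightarrow> ('k, 'w, 'n) module_scheme
      \<Rightarrow> ('k, 'v1, 'm1) module_scheme \<Rightarrow> ('k, 'w1, 'n1) module_scheme
      \<Rightarrow> ('v \<Rightarrow> 'v1) \<Rightarrow> ('w \<Rightarrow> 'w1) \<Rightarrow> ('v \<times> 'w \<Rightarrow> 'k) set \<Rightarrow> ('v1 \<times> 'w1 \<Rightarrow> 'k) set"
  where "tensor_map K V W V' W' f g =
    tensor_lift K V W (tensor K V' W') (\<lambda>x y. pure_tensor K V' W' (f x) (g y))"

definition tensor_assoc ::
    "('k, 'r) ring_scheme \<Rightarrow> ('k, 'u, 'l) module_scheme \<Rightarrow> ('k, 'v, 'm) module_scheme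
      \<Rightarrow> ('k, 'w, 'n) module_scheme
      \<Rightarrow> (('u \<times> 'v \<Rightarrow> 'k) set \<times> 'w \<Rightarrow> 'k) set \<Rightarrow> ('u \<times> ('v \<times> 'w \<Rightarrow> 'k) set \<Rightarrow> 'k) set"
  where "tensor_assoc K U V W =
    tensor_lift K (tensor K U V) W (tensor K U (tensor K V W))
      (\<lambda>s z. tensor_lift K U V (tensor K U (tensor K V W))
         (\<lambda>x y. pure_tensor K U (tensor K V W) x (pure_tensor K V W y z)) s)"

definition tensor_swap ::
    "('k, 'r) ring_scheme \<Rightarrow> ('k, 'v, 'm) module_scheme \<Rightarrow> ('k, 'w, 'n) module_scheme
      \<Rightarrow> ('v \<times> 'w \<Rightarrow> 'k) set \<Rightarrow> ('w \<times> 'v \<Rightarrow> 'k) set"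
  where "tensor_swap K V W =
    tensor_lift K V W (tensor K W V) (\<lambda>x y. pure_tensor K W V y x)"


section \<open>Coalgebras and comodules\<close>

record ('k, 'c) coalgebra = "('k, 'c) module" +
  comult :: "'c \<Rightarrow> ('c \<times> 'c \<Rightarrow> 'k) set"
  counit :: "'c \<Rightarrow> 'k"

locale cocommutative_coalgebra = K?: field K + C?: module K C
  for K :: "'k ring" and C :: "('k, 'c) coalgebra" +
  assumes comult_linear: "linear_map K C (tensor K C C) (comult C)"
    and counit_linear: "linear_map K C (base_space K) (counit C)"
    and coassoc: "x \<in> carrier C \<Longrightarrow>
      tensor_assoc K C C C (tensor_map K C C (tensor K C C) C (comult C) id (comult C x))
        = tensor_map K C C C (tensor K C C) id (comult C) (comult C x)"
    and counit_left: "x \<in> carrier C \<Longrightarrow>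
      tensor_lift K C C C (\<lambda>x1 x2. counit C x1 \<odot>\<^bsub>C\<^esub> x2) (comult C x) = x"
    and counit_right: "x \<in> carrier C \<Longrightarrow>
      tensor_lift K C C C (\<lambda>x1 x2. counit C x2 \<odot>\<^bsub>C\<^esub> x1) (comult C x) = x"
    and cocomm: "x \<in> carrier C \<Longrightarrow> tensor_swap K C C (comult C x) = comult C x"

record ('k, 'd, 'c) comodule = "('k, 'd) module" +
  coact :: "'d \<Rightarrow> ('c \<times> 'd \<Rightarrow> 'k) set"

locale left_comodule = K?: field K + D?: module K D
  for K :: "'k ring" and C :: "('k, 'c) coalgebra" and D :: "('k, 'd, 'c) comodule" +
  assumes coact_linear: "linear_map K D (tensor K C D) (coact D)"
    and coact_coassoc: "y \<in> carrier D \<Longrightarrow>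
      tensor_assoc K C C D (tensor_map K C D (tensor K C C) D (comult C) id (coact D y))
        = tensor_map K C D C (tensor K C D) id (coact D) (coact D y)"
    and coact_counit: "y \<in> carrier D \<Longrightarrow>
      tensor_lift K C D D (\<lambda>c d. counit C c \<odot>\<^bsub>D\<^esub> d) (coact D y) = y"


section \<open>Operads with multiplication and cyclic unital comp modules\<close>

text \<open>
  \<open>pcomp \<O> p q i u v\<close> is \<open>u \<circ>\<^sub>i v\<close> for \<open>u \<in> \<O>(p)\<close>, \<open>v \<in> \<O>(q)\<close> and \<open>i \<ge> 1\<close>.  The degrees are
  explicit because the carriers of the \<open>\<O>(n)\<close> need not be disjoint.
\<close>

record ('k, 'o) operad =
  op_space :: "nat \<Rightarrow> ('k, 'o) module"
  pcomp :: "nat \<Rightarrow> nat \<Rightarrow> nat \<Rightarrow> 'o \<Rightarrow> 'o \<Rightarrow> 'o"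
  op_id :: 'o
  op_mult :: 'o
  op_unit :: 'o

text \<open>
  For \<open>p = q = 0\<close> the degree \<open>p + q - 1\<close> is negative and truncates to \<open>0\<close>; there the composition
  is zero.  For the same reason the associativity laws are restricted to \<open>p \<ge> 1\<close>: for \<open>p = 0\<close>
  both sides vanish.
\<close>

locale operad_with_mult = K?: field K
  for K :: "'k ring" and \<O> :: "('k, 'o) operad" +
  assumes op_space: "module K (op_space \<O> n)"
    and pcomp_bilinear: "1 \<le> i \<Longrightarrow>
      bilinear_map K (op_space \<O> p) (op_space \<O> q) (op_space \<O> (p + q - 1)) (pcomp \<O> p q i)"
    and pcomp_zero: "\<lbrakk>u \<in> carrier (op_space \<O> p); v \<in> carrier (op_space \<O> q); 1 \<le> i; p < i \<or> p = 0\<rbrakk>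
      \<Longrightarrow> pcomp \<O> p q i u v = \<zero>\<^bsub>op_space \<O> (p + q - 1)\<^esub>"
    and pcomp_assoc_less:
      "\<lbrakk>u \<in> carrier (op_space \<O> p); v \<in> carrier (op_space \<O> q); w \<in> carrier (op_space \<O> r);
        1 \<le> p; 1 \<le> j; j < i\<rbrakk>
      \<Longrightarrow> pcomp \<O> (p + q - 1) r j (pcomp \<O> p q i u v) w
        = pcomp \<O> (p + r - 1) q (i + r - 1) (pcomp \<O> p r j u w) v"
    and pcomp_assoc_nested:
      "\<lbrakk>u \<in> carrier (op_space \<O> p); v \<in> carrier (op_space \<O> q); w \<in> carrier (op_space \<O> r);
        1 \<le> p; 1 \<le> i; i \<le> j; j < q + i\<rbrakk>
      \<Longrightarrow> pcomp \<O> (p + q - 1) r j (pcomp \<O> p q i u v) w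
        = pcomp \<O> p (q + r - 1) i u (pcomp \<O> q r (j + 1 - i) v w)"
    and pcomp_assoc_greater:
      "\<lbrakk>u \<in> carrier (op_space \<O> p); v \<in> carrier (op_space \<O> q); w \<in> carrier (op_space \<O> r);
        1 \<le> p; 1 \<le> i; q + i \<le> j\<rbrakk>
      \<Longrightarrow> pcomp \<O> (p + q - 1) r j (pcomp \<O> p q i u v) w
        = pcomp \<O> (p + r - 1) q i (pcomp \<O> p r (j + 1 - q) u w) v"
    and op_id_closed: "op_id \<O> \<in> carrier (op_space \<O> 1)"
    and op_id_right: "\<lbrakk>u \<in> carrier (op_space \<O> p); 1 \<le> i; i \<le> p\<rbrakk>
      \<Longrightarrow> pcomp \<O> p 1 i u (op_id \<O>) = u"
    and op_id_left: "u \<in> carrier (op_space \<O> p) \<Longrightarrow> pcomp \<O> 1 p 1 (op_id \<O>) u = u"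
    and op_mult_closed: "op_mult \<O> \<in> carrier (op_space \<O> 2)"
    and op_unit_closed: "op_unit \<O> \<in> carrier (op_space \<O> 0)"
    and op_mult_assoc:
      "pcomp \<O> 2 2 1 (op_mult \<O>) (op_mult \<O>) = pcomp \<O> 2 2 2 (op_mult \<O>) (op_mult \<O>)"
    and op_mult_unit_left: "pcomp \<O> 2 0 1 (op_mult \<O>) (op_unit \<O>) = op_id \<O>"
    and op_mult_unit_right: "pcomp \<O> 2 0 2 (op_mult \<O>) (op_unit \<O>) = op_id \<O>"

text \<open>\<open>act \<L> p n i u l\<close> is \<open>u \<bullet>\<^sub>i l\<close> for \<open>u \<in> \<O>(p)\<close>, \<open>l \<in> \<L>(n)\<close>.\<close>

record ('k, 'o, 'l) comp_module =
  cm_space :: "nat \<Rightarrow> ('k, 'l) module"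
  act :: "nat \<Rightarrow> nat \<Rightarrow> nat \<Rightarrow> 'o \<Rightarrow> 'l \<Rightarrow> 'l"
  cm_cyc :: "nat \<Rightarrow> 'l \<Rightarrow> 'l"

text \<open>
  The three composition laws cover \<open>p > 0\<close> and \<open>p = 0\<close> at once: for \<open>p = 0\<close> the hypotheses of
  \<open>act_act_nested\<close> are contradictory.  Each law is stated for those indices for which
  \<open>u \<bullet>\<^sub>i (v \<bullet>\<^sub>j l)\<close> is defined.  In \<open>act_zero\<close> the degree \<open>n + 1 - p\<close> of the
  result is negative and truncates to \<open>0\<close>.
\<close>

locale cyclic_unital_comp_module = operad_with_mult K \<O>
  for K :: "'k ring" and \<O> :: "('k, 'o) operad" and \<L> :: "('k, 'o, 'l) comp_module" +
  assumes cm_space: "module K (cm_space \<L> n)"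
    and act_bilinear: "\<lbrakk>p \<le> n + 1; i \<le> n + 1 - p\<rbrakk>
      \<Longrightarrow> bilinear_map K (op_space \<O> p) (cm_space \<L> n) (cm_space \<L> (n + 1 - p)) (act \<L> p n i)"
    and act_zero: "\<lbrakk>u \<in> carrier (op_space \<O> p); l \<in> carrier (cm_space \<L> n); n + 1 < p\<rbrakk>
      \<Longrightarrow> act \<L> p n i u l = \<zero>\<^bsub>cm_space \<L> (n + 1 - p)\<^esub>"
    and act_act_less:
      "\<lbrakk>u \<in> carrier (op_space \<O> p); v \<in> carrier (op_space \<O> q); l \<in> carrier (cm_space \<L> n);
        j + q \<le> n + 1; i + p + q \<le> n + 2; j < i\<rbrakk>
      \<Longrightarrow> act \<L> p (n + 1 - q) i u (act \<L> q n j v l)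
        = act \<L> q (n + 1 - p) j v (act \<L> p n (i + q - 1) u l)"
    and act_act_nested:
      "\<lbrakk>u \<in> carrier (op_space \<O> p); v \<in> carrier (op_space \<O> q); l \<in> carrier (cm_space \<L> n);
        j + q \<le> n + 1; i + p + q \<le> n + 2; j < i + p; i \<le> j\<rbrakk>
      \<Longrightarrow> act \<L> p (n + 1 - q) i u (act \<L> q n j v l)
        = act \<L> (p + q - 1) n i (pcomp \<O> p q (j + 1 - i) u v) l"
    and act_act_greater:
      "\<lbrakk>u \<in> carrier (op_space \<O> p); v \<in> carrier (op_space \<O> q); l \<in> carrier (cm_space \<L> n);
        j + q \<le> n + 1; i + p + q \<le> n + 2; i + p \<le> j\<rbrakk>
      \<Longrightarrow> act \<L> p (n + 1 - q) i u (act \<L> q n j v l)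
        = act \<L> q (n + 1 - p) (j + 1 - p) v (act \<L> p n i u l)"
    and act_id: "\<lbrakk>l \<in> carrier (cm_space \<L> n); i \<le> n\<rbrakk> \<Longrightarrow> act \<L> 1 n i (op_id \<O>) l = l"
    and cm_cyc_linear: "linear_map K (cm_space \<L> n) (cm_space \<L> n) (cm_cyc \<L> n)"
    and cm_cyc_0: "l \<in> carrier (cm_space \<L> 0) \<Longrightarrow> cm_cyc \<L> 0 l = l"
    and cm_cyc_act:
      "\<lbrakk>u \<in> carrier (op_space \<O> p); l \<in> carrier (cm_space \<L> n); i + p \<le> n\<rbrakk>
      \<Longrightarrow> cm_cyc \<L> (n + 1 - p) (act \<L> p n i u l) = act \<L> p n (i + 1) u (cm_cyc \<L> n l)"
    and cm_cyc_power: "l \<in> carrier (cm_space \<L> n) \<Longrightarrow> (cm_cyc \<L> n ^^ (n + 1)) l = l"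


section \<open>Measurings\<close>

text \<open>
  Linearity of \<open>\<Psi> n : C \<rightarrow> Vect K (\<O>(n), \<O>'(n))\<close> is expressed as bilinearity of
  \<open>(x, u) \<mapsto> \<Psi> n x u\<close>; likewise for \<open>\<Omega> n\<close>.
\<close>

definition operad_measuring ::
    "'k ring \<Rightarrow> ('k, 'c) coalgebra \<Rightarrow> ('k, 'o) operad \<Rightarrow> ('k, 'p) operad
      \<Rightarrow> (nat \<Rightarrow> 'c \<Rightarrow> 'o \<Rightarrow> 'p) \<Rightarrow> bool"
  where "operad_measuring K C \<O> \<O>' \<Psi> \<longleftrightarrow>
    (\<forall>n. bilinear_map K C (op_space \<O> n) (op_space \<O>' n) (\<Psi> n)) \<and>
    (\<forall>p q i. \<forall>x\<in>carrier C. \<forall>u\<in>carrier (op_space \<O> p). \<forall>v\<in>carrier (op_space \<O> q). 1 \<le> i \<longrightarrow>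
       \<Psi> (p + q - 1) x (pcomp \<O> p q i u v)
         = tensor_lift K C C (op_space \<O>' (p + q - 1))
             (\<lambda>x1 x2. pcomp \<O>' p q i (\<Psi> p x1 u) (\<Psi> q x2 v)) (comult C x)) \<and>
    (\<forall>x\<in>carrier C. \<Psi> 2 x (op_mult \<O>) = counit C x \<odot>\<^bsub>op_space \<O>' 2\<^esub> op_mult \<O>') \<and>
    (\<forall>x\<in>carrier C. \<Psi> 0 x (op_unit \<O>) = counit C x \<odot>\<^bsub>op_space \<O>' 0\<^esub> op_unit \<O>')"

definition comodule_measuring ::
    "'k ring \<Rightarrow> ('k, 'c) coalgebra \<Rightarrow> ('k, 'o) operad \<Rightarrow> (nat \<Rightarrow> 'c \<Rightarrow> 'o \<Rightarrow> 'p)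
      \<Rightarrow> ('k, 'd, 'c) comodule \<Rightarrow> ('k, 'o, 'l) comp_module \<Rightarrow> ('k, 'p, 'm) comp_module
      \<Rightarrow> (nat \<Rightarrow> 'd \<Rightarrow> 'l \<Rightarrow> 'm) \<Rightarrow> bool"
  where "comodule_measuring K C \<O> \<Psi> D \<L> \<L>' \<Omega> \<longleftrightarrow>
    (\<forall>n. bilinear_map K D (cm_space \<L> n) (cm_space \<L>' n) (\<Omega> n)) \<and>
    (\<forall>p n i. \<forall>y\<in>carrier D. \<forall>u\<in>carrier (op_space \<O> p). \<forall>l\<in>carrier (cm_space \<L> n).
       i + p \<le> n + 1 \<longrightarrow>
       \<Omega> (n + 1 - p) y (act \<L> p n i u l)
         = tensor_lift K C D (cm_space \<L>' (n + 1 - p))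
             (\<lambda>c d. act \<L>' p n i (\<Psi> p c u) (\<Omega> n d l)) (coact D y)) \<and>
    (\<forall>n. \<forall>y\<in>carrier D. \<forall>l\<in>carrier (cm_space \<L> n).
       \<Omega> n y (cm_cyc \<L> n l) = cm_cyc \<L>' n (\<Omega> n y l))"


section \<open>Cyclic homology\<close>

record ('k, 'l) cyclic_module =
  cy_space :: "nat \<Rightarrow> ('k, 'l) module"
  face :: "nat \<Rightarrow> nat \<Rightarrow> 'l \<Rightarrow> 'l"
  degen :: "nat \<Rightarrow> nat \<Rightarrow> 'l \<Rightarrow> 'l"
  cyc :: "nat \<Rightarrow> 'l \<Rightarrow> 'l"

definition cyclic_module_of ::
    "('k, 'o) operad \<Rightarrow> ('k, 'o, 'l) comp_module \<Rightarrow> ('k, 'l) cyclic_module"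
  where "cyclic_module_of \<O> \<L> =
    \<lparr>cy_space = cm_space \<L>,
     face = (\<lambda>n i l. if i < n then act \<L> 2 n i (op_mult \<O>) l
                     else act \<L> 2 n 0 (op_mult \<O>) (cm_cyc \<L> n l)),
     degen = (\<lambda>n j l. act \<L> 0 n (j + 1) (op_unit \<O>) l),
     cyc = cm_cyc \<L>\<rparr>"

text \<open>
  Since \<open>K\<close> has arbitrary characteristic, cyclic homology is taken to be the homology of the
  total complex of the cyclic bicomplex (Loday, Cyclic Homology, Section 2.1), with \<open>X(q)\<close> in
  bidegree \<open>(p, q)\<close>, vertical differentials \<open>b\<close> in even and \<open>-b'\<close> in odd columns, and horizontal
  differentials \<open>1 - \<lambda>\<close> out of odd and \<open>N\<close> out of positive even columns.  Here \<open>\<lambda> = (-1)\<^sup>n t\<close> on \<open>X(n)\<close>,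
  as the cyclic operator \<open>t\<close> itself carries no sign.  The bicomplex does not involve the
  degeneracies.
\<close>

definition signed :: "('k, 'l) module \<Rightarrow> nat \<Rightarrow> 'l \<Rightarrow> 'l"
  where "signed V i x = (if even i then x else \<ominus>\<^bsub>V\<^esub> x)"

definition hoch_b :: "('k, 'l) cyclic_module \<Rightarrow> nat \<Rightarrow> 'l \<Rightarrow> 'l"
  where "hoch_b X n x =
    (\<Oplus>\<^bsub>cy_space X (n - 1)\<^esub>i\<in>{..n}. signed (cy_space X (n - 1)) i (face X n i x))"

definition hoch_b' :: "('k, 'l) cyclic_module \<Rightarrow> nat \<Rightarrow> 'l \<Rightarrow> 'l"
  where "hoch_b' X n x =
    (\<Oplus>\<^bsub>cy_space X (n - 1)\<^esub>i\<in>{..<n}. signed (cy_space X (n - 1)) i (face X n i x))"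

definition cyc_signed :: "('k, 'l) cyclic_module \<Rightarrow> nat \<Rightarrow> 'l \<Rightarrow> 'l"
  where "cyc_signed X n x = signed (cy_space X n) n (cyc X n x)"

definition cyc_norm :: "('k, 'l) cyclic_module \<Rightarrow> nat \<Rightarrow> 'l \<Rightarrow> 'l"
  where "cyc_norm X n x = (\<Oplus>\<^bsub>cy_space X n\<^esub>i\<in>{..n}. (cyc_signed X n ^^ i) x)"

definition vert_diff :: "('k, 'l) cyclic_module \<Rightarrow> nat \<Rightarrow> nat \<Rightarrow> 'l \<Rightarrow> 'l"
  where "vert_diff X p q x =
    (if even p then hoch_b X q x else \<ominus>\<^bsub>cy_space X (q - 1)\<^esub> hoch_b' X q x)"

definition horiz_diff :: "('k, 'l) cyclic_module \<Rightarrow> nat \<Rightarrow> nat \<Rightarrow> 'l \<Rightarrow> 'l"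
  where "horiz_diff X p q x =
    (if odd p then x \<ominus>\<^bsub>cy_space X q\<^esub> cyc_signed X q x else cyc_norm X q x)"

text \<open>An element \<open>z\<close> of \<open>Tot\<^sub>n\<close> has component \<open>z p \<in> X(n - p)\<close> in column \<open>p\<close>.\<close>

definition tot_space :: "('k, 'l) cyclic_module \<Rightarrow> nat \<Rightarrow> ('k, nat \<Rightarrow> 'l) module"
  where "tot_space X n =
    \<lparr>carrier = (\<Pi>\<^sub>E p\<in>{..n}. carrier (cy_space X (n - p))),
     mult = undefined, one = undefined,
     zero = (\<lambda>p\<in>{..n}. \<zero>\<^bsub>cy_space X (n - p)\<^esub>),
     add = (\<lambda>z w. \<lambda>p\<in>{..n}. z p \<oplus>\<^bsub>cy_space X (n - p)\<^esub> w p),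
     smult = (\<lambda>a z. \<lambda>p\<in>{..n}. a \<odot>\<^bsub>cy_space X (n - p)\<^esub> z p)\<rparr>"

text \<open>\<open>tot_diff X n\<close> maps \<open>Tot\<^sub>n\<^sub>+\<^sub>1\<close> to \<open>Tot\<^sub>n\<close>.\<close>

definition tot_diff :: "('k, 'l) cyclic_module \<Rightarrow> nat \<Rightarrow> (nat \<Rightarrow> 'l) \<Rightarrow> nat \<Rightarrow> 'l"
  where "tot_diff X n z =
    (\<lambda>p\<in>{..n}. vert_diff X p (Suc n - p) (z p)
       \<oplus>\<^bsub>cy_space X (n - p)\<^esub> horiz_diff X (Suc p) (n - p) (z (Suc p)))"

definition cyclic_cycles :: "('k, 'l) cyclic_module \<Rightarrow> nat \<Rightarrow> (nat \<Rightarrow> 'l) set"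
  where "cyclic_cycles X n =
    (case n of 0 \<Rightarrow> carrier (tot_space X 0)
     | Suc m \<Rightarrow> {z \<in> carrier (tot_space X (Suc m)). tot_diff X m z = \<zero>\<^bsub>tot_space X m\<^esub>})"

definition cyclic_boundaries :: "('k, 'l) cyclic_module \<Rightarrow> nat \<Rightarrow> (nat \<Rightarrow> 'l) set"
  where "cyclic_boundaries X n = tot_diff X n ` carrier (tot_space X (Suc n))"

definition cyclic_homology :: "('k, 'l) cyclic_module \<Rightarrow> nat \<Rightarrow> ('k, (nat \<Rightarrow> 'l) set) module"
  where "cyclic_homology X n =
    quotient_space ((tot_space X n)\<lparr>carrier := cyclic_cycles X n\<rparr>) (cyclic_boundaries X n)"

definition cyclic_class :: "('k, 'l) cyclic_module \<Rightarrow> nat \<Rightarrow> (nat \<Rightarrow> 'l) \<Rightarrow> (nat \<Rightarrow> 'l) set"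
  where "cyclic_class X n z = cyclic_boundaries X n +>\<^bsub>tot_space X n\<^esub> z"

text \<open>The homology \<open>HC\<^sub>n(\<O>, \<L>)\<close>.\<close>

definition HC ::
    "('k, 'o) operad \<Rightarrow> ('k, 'o, 'l) comp_module \<Rightarrow> nat \<Rightarrow> ('k, (nat \<Rightarrow> 'l) set) module"
  where "HC \<O> \<L> = cyclic_homology (cyclic_module_of \<O> \<L>)"

text \<open>The map \<open>Tot\<^sub>n(X) \<rightarrow> Tot\<^sub>n(X')\<close> given componentwise by \<open>f n : X(n) \<rightarrow> X'(n)\<close>.\<close>

definition tot_map :: "(nat \<Rightarrow> 'l \<Rightarrow> 'm) \<Rightarrow> nat \<Rightarrow> (nat \<Rightarrow> 'l) \<Rightarrow> nat \<Rightarrow> 'm"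
  where "tot_map f n z = (\<lambda>p\<in>{..n}. f (n - p) (z p))"

end

theory Submission
  imports Defs
begin

text \<open>
  For fixed \<open>y\<close> the maps \<open>\<Omega>\<^sub>n(y)\<close> are linear and commute with \<open>t\<close> by hypothesis.  They also commute
  with \<open>l \<mapsto> m \<bullet>\<^sub>i l\<close>: since \<open>\<Psi>\<^sub>2(c)(m) = \<epsilon>(c) m'\<close>, the expression
  \<open>\<Psi>\<^sub>2(y\<^sub>(\<^sub>0\<^sub>))(m) \<bullet>\<^sub>i \<Omega>\<^sub>n(y\<^sub>(\<^sub>1\<^sub>))(l)\<close> equals \<open>m' \<bullet>\<^sub>i \<Omega>\<^sub>n(\<epsilon>(y\<^sub>(\<^sub>0\<^sub>)) y\<^sub>(\<^sub>1\<^sub>))(l) = m' \<bullet>\<^sub>i \<Omega>\<^sub>n(y)(l)\<close>, where pulling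
  the linear map out of the Sweedler sum is the universal property of the tensor product.  Hence
  the \<open>\<Omega>\<^sub>n(y)\<close> commute with all differentials of the cyclic bicomplex.
\<close>

section \<open>Linear maps\<close>

lemma linear_mapI:
  assumes "\<And>x. x \<in> carrier V \<Longrightarrow> f x \<in> carrier W"
    and "\<And>x y. x \<in> carrier V \<Longrightarrow> y \<in> carrier V \<Longrightarrow> f (x \<oplus>\<^bsub>V\<^esub> y) = f x \<oplus>\<^bsub>W\<^esub> f y"
    and "\<And>a x. a \<in> carrier K \<Longrightarrow> x \<in> carrier V \<Longrightarrow> f (a \<odot>\<^bsub>V\<^esub> x) = a \<odot>\<^bsub>W\<^esub> f x"
  shows "linear_map K V W f"
  using assms by (auto simp: linear_map_def)

lemma linear_map_closed: "linear_map K V W f \<Longrightarrow> x \<in> carrier V \<Longrightarrow> f x \<in> carrier W"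
  by (auto simp: linear_map_def)

lemma linear_map_add:
  "linear_map K V W f \<Longrightarrow> x \<in> carrier V \<Longrightarrow> y \<in> carrier V \<Longrightarrow> f (x \<oplus>\<^bsub>V\<^esub> y) = f x \<oplus>\<^bsub>W\<^esub> f y"
  by (auto simp: linear_map_def)

lemma linear_map_smult:
  "linear_map K V W f \<Longrightarrow> a \<in> carrier K \<Longrightarrow> x \<in> carrier V \<Longrightarrow> f (a \<odot>\<^bsub>V\<^esub> x) = a \<odot>\<^bsub>W\<^esub> f x"
  by (auto simp: linear_map_def)

text \<open>Homogeneity at the scalar zero gives this directly, since zero times any vector is the
  zero vector on both sides.\<close>

lemma linear_map_zero:
  assumes "module K V" "module K W" "linear_map K V W f"
  shows "f \<zero>\<^bsub>V\<^esub> = \<zero>\<^bsub>W\<^esub>"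
proof -
  interpret V: module K V by fact
  interpret W: module K W by fact
  have "f (\<zero>\<^bsub>K\<^esub> \<odot>\<^bsub>V\<^esub> \<zero>\<^bsub>V\<^esub>) = \<zero>\<^bsub>K\<^esub> \<odot>\<^bsub>W\<^esub> f \<zero>\<^bsub>V\<^esub>"
    by (rule linear_map_smult[OF assms(3)]) simp_all
  then show ?thesis using linear_map_closed[OF assms(3)] by simp
qed

text \<open>Writing negation as a scalar multiple turns preservation of negatives into a case of
  homogeneity.\<close>

lemma (in module) a_inv_eq_smult: "x \<in> carrier M \<Longrightarrow> \<ominus>\<^bsub>M\<^esub> x = (\<ominus> \<one>) \<odot>\<^bsub>M\<^esub> x"
  by (simp add: smult_l_minus)

lemma (in abelian_group) minus_eq_zero_iff:
  assumes "x \<in> carrier G" "y \<in> carrier G"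
  shows "x \<ominus> y = \<zero> \<longleftrightarrow> x = y"
  using assms by (metis a_inv_closed a_minus_def minus_equality minus_minus r_neg)

lemma linear_map_a_inv:
  assumes "module K V" "module K W" "linear_map K V W f" "x \<in> carrier V"
  shows "f (\<ominus>\<^bsub>V\<^esub> x) = \<ominus>\<^bsub>W\<^esub> f x"
proof -
  interpret V: module K V by fact
  interpret W: module K W by fact
  show ?thesis
    using linear_map_smult[OF assms(3), of "\<ominus>\<^bsub>K\<^esub> \<one>\<^bsub>K\<^esub>" x] linear_map_closed[OF assms(3,4)] assms(4)
    by (simp add: V.a_inv_eq_smult W.a_inv_eq_smult)
qed

lemma linear_map_minus:
  assumes "module K V" "module K W" "linear_map K V W f" "x \<in> carrier V" "y \<in> carrier V"
  shows "f (x \<ominus>\<^bsub>V\<^esub> y) = f x \<ominus>\<^bsub>W\<^esub> f y"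
proof -
  interpret V: module K V by fact
  show ?thesis
    using assms linear_map_add[OF assms(3)] by (simp add: a_minus_def linear_map_a_inv)
qed

lemma linear_map_finsum:
  assumes "module K V" "module K W" "linear_map K V W f" "finite A" "g \<in> A \<rightarrow> carrier V"
  shows "f (\<Oplus>\<^bsub>V\<^esub>i\<in>A. g i) = (\<Oplus>\<^bsub>W\<^esub>i\<in>A. f (g i))"
proof -
  interpret V: module K V by fact
  interpret W: module K W by fact
  show ?thesis using assms(4,5)
  proof (induction rule: finite_induct)
    case empty
    then show ?case using linear_map_zero[OF assms(1-3)] by simp
  next
    case (insert x F)
    then have "g \<in> F \<rightarrow> carrier V" "g x \<in> carrier V" "(\<lambda>i. f (g i)) \<in> F \<rightarrow> carrier W" "f (g x) \<in> carrier W"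
      using linear_map_closed[OF assms(3)] by auto
    then show ?case using insert linear_map_add[OF assms(3)] by simp
  qed
qed

lemma linear_map_id: "linear_map K V V (\<lambda>x. x)"
  by (auto simp: linear_map_def)

lemma linear_map_compose:
  "linear_map K U V f \<Longrightarrow> linear_map K V W g \<Longrightarrow> linear_map K U W (\<lambda>x. g (f x))"
  unfolding linear_map_def by (auto simp: Pi_iff)

lemma linear_map_plus:
  assumes "module K W" "linear_map K V W f" "linear_map K V W g"
  shows "linear_map K V W (\<lambda>x. f x \<oplus>\<^bsub>W\<^esub> g x)"
proof -
  interpret W: module K W by fact
  note f = linear_map_closed[OF assms(2)] and g = linear_map_closed[OF assms(3)]
  show ?thesis
    using f g linear_map_add[OF assms(2)] linear_map_add[OF assms(3)]
      linear_map_smult[OF assms(2)] linear_map_smult[OF assms(3)]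
    by (intro linear_mapI) (auto simp: W.smult_r_distr W.a_ac)
qed

lemma linear_map_uminus:
  assumes "module K W" "linear_map K V W f"
  shows "linear_map K V W (\<lambda>x. \<ominus>\<^bsub>W\<^esub> f x)"
proof -
  interpret W: module K W by fact
  show ?thesis
    using linear_map_closed[OF assms(2)] linear_map_add[OF assms(2)] linear_map_smult[OF assms(2)]
    by (intro linear_mapI) (auto simp: W.smult_r_minus W.minus_add)
qed

lemma linear_map_sum:
  assumes "module K W" "finite A" "\<And>i. i \<in> A \<Longrightarrow> linear_map K V W (f i)"
  shows "linear_map K V W (\<lambda>x. \<Oplus>\<^bsub>W\<^esub>i\<in>A. f i x)"
proof -
  interpret W: module K W by fact
  have cl: "(\<lambda>i. f i x) \<in> A \<rightarrow> carrier W" if "x \<in> carrier V" for x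
    using linear_map_closed[OF assms(3)] that by auto
  show ?thesis
  proof (rule linear_mapI)
    fix x y assume xy: "x \<in> carrier V" "y \<in> carrier V"
    have "(\<Oplus>\<^bsub>W\<^esub>i\<in>A. f i (x \<oplus>\<^bsub>V\<^esub> y)) = (\<Oplus>\<^bsub>W\<^esub>i\<in>A. f i x \<oplus>\<^bsub>W\<^esub> f i y)"
      using xy cl[OF xy(1)] cl[OF xy(2)] linear_map_add[OF assms(3)]
      by (intro W.finsum_cong') (auto simp: Pi_iff)
    also have "\<dots> = (\<Oplus>\<^bsub>W\<^esub>i\<in>A. f i x) \<oplus>\<^bsub>W\<^esub> (\<Oplus>\<^bsub>W\<^esub>i\<in>A. f i y)"
      using cl xy by (intro W.finsum_addf) auto
    finally show "(\<Oplus>\<^bsub>W\<^esub>i\<in>A. f i (x \<oplus>\<^bsub>V\<^esub> y)) = (\<Oplus>\<^bsub>W\<^esub>i\<in>A. f i x) \<oplus>\<^bsub>W\<^esub> (\<Oplus>\<^bsub>W\<^esub>i\<in>A. f i y)" .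
  next
    fix a x assume ax: "a \<in> carrier K" "x \<in> carrier V"
    have "(\<Oplus>\<^bsub>W\<^esub>i\<in>A. f i (a \<odot>\<^bsub>V\<^esub> x)) = (\<Oplus>\<^bsub>W\<^esub>i\<in>A. a \<odot>\<^bsub>W\<^esub> f i x)"
      using ax cl[OF ax(2)] linear_map_smult[OF assms(3)]
      by (intro W.finsum_cong') (auto simp: Pi_iff)
    then show "(\<Oplus>\<^bsub>W\<^esub>i\<in>A. f i (a \<odot>\<^bsub>V\<^esub> x)) = a \<odot>\<^bsub>W\<^esub> (\<Oplus>\<^bsub>W\<^esub>i\<in>A. f i x)"
      using W.finsum_smult_ldistr[OF assms(2) ax(1) cl[OF ax(2)]] by simp
  qed (use cl in auto)
qed

section \<open>Kernels and images as subspaces, later applied to cycles and boundaries\<close>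

lemma submodule_kernel:
  assumes "module K V" "module K W" "linear_map K V W f"
  shows "submodule {x \<in> carrier V. f x = \<zero>\<^bsub>W\<^esub>} K V"
proof -
  interpret V: module K V by fact
  interpret W: module K W by fact
  show ?thesis
    using linear_map_zero[OF assms] linear_map_a_inv[OF assms] linear_map_add[OF assms(3)]
      linear_map_smult[OF assms(3)]
    by (intro V.submoduleI) auto
qed

lemma submodule_image:
  assumes "module K V" "module K W" "linear_map K V W f"
  shows "submodule (f ` carrier V) K W"
proof -
  interpret V: module K V by fact
  interpret W: module K W by fact
  show ?thesis
  proof (rule W.submoduleI)
    show "\<zero>\<^bsub>W\<^esub> \<in> f ` carrier V"
      using linear_map_zero[OF assms] by (metis V.zero_closed image_eqI)
    show "f ` carrier V \<subseteq> carrier W" using linear_map_closed[OF assms(3)] by auto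
  next
    fix a assume "a \<in> f ` carrier V"
    then show "\<ominus>\<^bsub>W\<^esub> a \<in> f ` carrier V"
      using linear_map_a_inv[OF assms] by (auto intro!: image_eqI[OF _ V.a_inv_closed])
  next
    fix a b assume "a \<in> f ` carrier V" "b \<in> f ` carrier V"
    then show "a \<oplus>\<^bsub>W\<^esub> b \<in> f ` carrier V"
      using linear_map_add[OF assms(3)] by (force simp flip: linear_map_add[OF assms(3)])
  next
    fix a x assume "a \<in> carrier K" "x \<in> f ` carrier V"
    then show "a \<odot>\<^bsub>W\<^esub> x \<in> f ` carrier V"
      using linear_map_smult[OF assms(3)] by (auto intro!: image_eqI[OF _ V.smult_closed])
  qed
qed

section \<open>Quotients\<close>

lemma submodule_abelian_subgroup:
  assumes "module K V" "submodule N K V"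
  shows "abelian_subgroup N V"
  using assms by (intro abelian_subgroupI3 additive_subgroupI) (auto simp: module_def submodule_def)

text \<open>Homology is formed in the record whose carrier is cut down to the cycles. Cosets involve
  only the addition, so they may be computed in the ambient space; the same holds for sums of sets
  below.\<close>

lemma a_r_coset_carrier_update [simp]: "N +>\<^bsub>V\<lparr>carrier := Z\<rparr>\<^esub> x = N +>\<^bsub>V\<^esub> x"
  by (simp add: a_r_coset_defs)

lemma set_add_carrier_update [simp]: "A <+>\<^bsub>V\<lparr>carrier := Z\<rparr>\<^esub> B = A <+>\<^bsub>V\<^esub> B"
  by (simp add: set_add_defs)

text \<open>The difference lies in \<open>N\<close> exactly when \<open>x\<close> lies in the coset
  of \<open>y\<close>, and a coset is determined by any of its elements.\<close>

lemma a_r_coset_eq_iff: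
  assumes "module K V" "submodule N K V" "x \<in> carrier V" "y \<in> carrier V"
  shows "N +>\<^bsub>V\<^esub> x = N +>\<^bsub>V\<^esub> y \<longleftrightarrow> x \<ominus>\<^bsub>V\<^esub> y \<in> N"
proof -
  interpret V: module K V by fact
  interpret N: abelian_subgroup N V by (rule submodule_abelian_subgroup[OF assms(1,2)])
  have "x \<ominus>\<^bsub>V\<^esub> y \<in> N \<longleftrightarrow> x \<in> N +>\<^bsub>V\<^esub> y"
    using N.a_rcos_module[OF assms(4,3)] by (simp add: a_minus_def)
  also have "\<dots> \<longleftrightarrow> N +>\<^bsub>V\<^esub> x = N +>\<^bsub>V\<^esub> y"
    using N.a_rcos_self[OF assms(3)] V.a_repr_independence[OF _ assms(4) N.a_subgroup, of x] by auto
  finally show ?thesis by simp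
qed

text \<open>\<open>quotient_space\<close> encodes scalar multiplication as a union over all
  representatives. All members of that union are one and the same coset, because \<open>N\<close> is
  stable under scalars.\<close>

lemma smult_quotient_space_coset:
  assumes "module K V" "submodule N K V" "a \<in> carrier K" "x \<in> carrier V"
  shows "(\<Union>x'\<in>N +>\<^bsub>V\<^esub> x. N +>\<^bsub>V\<^esub> (a \<odot>\<^bsub>V\<^esub> x')) = N +>\<^bsub>V\<^esub> (a \<odot>\<^bsub>V\<^esub> x)"
proof -
  interpret V: module K V by fact
  interpret N: abelian_subgroup N V by (rule submodule_abelian_subgroup[OF assms(1,2)])
  interpret N': submodule N K V by fact
  have "N +>\<^bsub>V\<^esub> (a \<odot>\<^bsub>V\<^esub> x') = N +>\<^bsub>V\<^esub> (a \<odot>\<^bsub>V\<^esub> x)" if "x' \<in> N +>\<^bsub>V\<^esub> x" for x'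
  proof -
    have x': "x' \<in> carrier V" using N.a_elemrcos_carrier[OF assms(4) that] .
    then have "x' \<ominus>\<^bsub>V\<^esub> x \<in> N" using that N.a_rcos_module[OF assms(4)] by (simp add: a_minus_def)
    then have "a \<odot>\<^bsub>V\<^esub> (x' \<ominus>\<^bsub>V\<^esub> x) \<in> N" using assms(3) by (rule N'.smult_closed[rotated])
    then have "a \<odot>\<^bsub>V\<^esub> x' \<ominus>\<^bsub>V\<^esub> a \<odot>\<^bsub>V\<^esub> x \<in> N"
      using assms(3,4) x' by (simp add: a_minus_def V.smult_r_distr V.smult_r_minus)
    then show ?thesis using a_r_coset_eq_iff[OF assms(1,2)] assms(3,4) x' by simp
  qed
  then show ?thesis using N.a_rcos_self[OF assms(4)] by blast
qed

section \<open>Quotients of a subspace \<open>Z\<close> by \<open>N\<close> and their universal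
  property\<close>

lemma quotient_space_carrier:
  "carrier (quotient_space (V\<lparr>carrier := Z\<rparr>) N) = (\<lambda>z. N +>\<^bsub>V\<^esub> z) ` Z"
  by (auto simp: quotient_space_def A_RCOSETS_defs a_r_coset_defs)

lemma linear_map_projection:
  assumes "module K V" "submodule N K V" "submodule Z K V"
  shows "linear_map K (V\<lparr>carrier := Z\<rparr>) (quotient_space (V\<lparr>carrier := Z\<rparr>) N) (\<lambda>z. N +>\<^bsub>V\<^esub> z)"
proof -
  interpret V: module K V by fact
  interpret N: abelian_subgroup N V by (rule submodule_abelian_subgroup[OF assms(1,2)])
  have Z: "z \<in> carrier V" if "z \<in> Z" for z using V.submoduleE(1)[OF assms(3)] that by auto
  show ?thesis
  proof (rule linear_mapI)
    fix a x assume "a \<in> carrier K" "x \<in> carrier (V\<lparr>carrier := Z\<rparr>)"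
    then show "N +>\<^bsub>V\<^esub> (a \<odot>\<^bsub>V\<lparr>carrier := Z\<rparr>\<^esub> x)
        = a \<odot>\<^bsub>quotient_space (V\<lparr>carrier := Z\<rparr>) N\<^esub> (N +>\<^bsub>V\<^esub> x)"
      using smult_quotient_space_coset[OF assms(1,2)] Z by (simp add: quotient_space_def)
  qed (auto simp: quotient_space_carrier Z N.a_rcos_sum, auto simp: Z N.a_rcos_sum quotient_space_def)
qed

text \<open>With \<open>Z\<close> the whole space this yields maps out of tensor products, with
  \<open>Z\<close> the cycles it yields maps out of homology. Extensionality fixes the values off
  the carrier, so that uniqueness is equality of HOL functions.\<close>

lemma quotient_space_lift:
  assumes "module K V" "submodule N K V" "submodule Z K V"
    and \<phi>: "linear_map K (V\<lparr>carrier := Z\<rparr>) X \<phi>"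
    and wd: "\<And>x y. x \<in> Z \<Longrightarrow> y \<in> Z \<Longrightarrow> x \<ominus>\<^bsub>V\<^esub> y \<in> N \<Longrightarrow> \<phi> x = \<phi> y"
  defines "Q \<equiv> quotient_space (V\<lparr>carrier := Z\<rparr>) N"
  shows "\<exists>!f. f \<in> extensional (carrier Q) \<and> linear_map K Q X f \<and> (\<forall>z\<in>Z. f (N +>\<^bsub>V\<^esub> z) = \<phi> z)"
proof -
  interpret V: module K V by fact
  have Z: "z \<in> carrier V" if "z \<in> Z" for z using V.submoduleE(1)[OF assms(3)] that by auto
  have cQ: "carrier Q = (\<lambda>z. N +>\<^bsub>V\<^esub> z) ` Z" unfolding Q_def by (rule quotient_space_carrier)
  have \<pi>: "linear_map K (V\<lparr>carrier := Z\<rparr>) Q (\<lambda>z. N +>\<^bsub>V\<^esub> z)"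
    unfolding Q_def by (rule linear_map_projection[OF assms(1-3)])
  \<comment> \<open>The value on a coset is read off from an arbitrary representative in
    \<open>Z\<close>; by \<open>wd\<close> the choice does not matter.\<close>
  define f where "f = (\<lambda>S\<in>carrier Q. \<phi> (SOME z. z \<in> Z \<and> S = N +>\<^bsub>V\<^esub> z))"
  have f: "f (N +>\<^bsub>V\<^esub> z) = \<phi> z" if z: "z \<in> Z" for z
  proof -
    have "\<phi> z' = \<phi> z" if z': "z' \<in> Z \<and> N +>\<^bsub>V\<^esub> z = N +>\<^bsub>V\<^esub> z'" for z'
      using wd[of z' z] a_r_coset_eq_iff[OF assms(1,2), of z' z] z z' Z by auto
    then have "\<phi> (SOME z'. z' \<in> Z \<and> N +>\<^bsub>V\<^esub> z = N +>\<^bsub>V\<^esub> z') = \<phi> z"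
      using z by (rule_tac someI2) blast+
    then show ?thesis using z cQ by (auto simp: f_def)
  qed
  have "linear_map K Q X f"
  proof (rule linear_mapI)
    fix S assume "S \<in> carrier Q"
    then show "f S \<in> carrier X" using f linear_map_closed[OF \<phi>] by (auto simp: cQ)
  next
    fix S T assume "S \<in> carrier Q" "T \<in> carrier Q"
    then obtain s t where "s \<in> Z" "S = N +>\<^bsub>V\<^esub> s" "t \<in> Z" "T = N +>\<^bsub>V\<^esub> t" by (auto simp: cQ)
    \<comment> \<open>Linearity of the projection identifies the sum of two cosets with the coset of
      \<open>s + t\<close>, where \<open>f\<close> is known.\<close>
    then show "f (S \<oplus>\<^bsub>Q\<^esub> T) = f S \<oplus>\<^bsub>X\<^esub> f T"
      using linear_map_add[OF \<pi>, of s t] linear_map_add[OF \<phi>, of s t] f V.submoduleE(5)[OF assms(3)]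
      by (simp add: \<open>S = _\<close> \<open>T = _\<close>) metis
  next
    fix a S assume "a \<in> carrier K" "S \<in> carrier Q"
    moreover then obtain s where "s \<in> Z" "S = N +>\<^bsub>V\<^esub> s" by (auto simp: cQ)
    ultimately show "f (a \<odot>\<^bsub>Q\<^esub> S) = a \<odot>\<^bsub>X\<^esub> f S"
      using linear_map_smult[OF \<pi>, of a s] linear_map_smult[OF \<phi>, of a s] f V.submoduleE(4)[OF assms(3)]
      by (simp add: \<open>S = _\<close>) metis
  qed
  moreover have "f \<in> extensional (carrier Q)" by (simp add: f_def)
  ultimately show ?thesis
  proof (intro ex1I[of _ f] conjI ballI)
    fix g assume g: "g \<in> extensional (carrier Q) \<and> linear_map K Q X g \<and> (\<forall>z\<in>Z. g (N +>\<^bsub>V\<^esub> z) = \<phi> z)"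
    show "g = f"
      by (rule extensionalityI[of _ "carrier Q"]) (use g f in \<open>auto simp: cQ f_def\<close>)
  qed (use f in auto)
qed

section \<open>The universal property of the tensor product\<close>

lemma module_free_space:
  fixes K :: "('k, 'r) ring_scheme"
  assumes "cring K"
  shows "module K (free_space K S)"
proof -
  interpret K: cring K by fact
  have cl: "f s \<in> carrier K" if "f \<in> carrier (free_space K S)" "s \<in> S" for f s
    using that by (auto simp: free_space_def)
  have fin: "finite {s \<in> S. f s \<noteq> \<zero>\<^bsub>K\<^esub>}" if "f \<in> carrier (free_space K S)" for f
    using that by (auto simp: free_space_def)
  \<comment> \<open>Elements are extensional on \<open>S\<close>, so equality is tested pointwise
    and each module axiom reduces to a ring axiom of \<open>K\<close>.\<close>
  have ext: "f = g" if "f \<in> carrier (free_space K S)" "g \<in> carrier (free_space K S)"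
    "\<And>s. s \<in> S \<Longrightarrow> f s = g s" for f g
    using that by (auto simp: free_space_def intro: PiE_ext)
  \<comment> \<open>Any finite \<open>A\<close> outside of which \<open>h\<close> vanishes will do,
    so the exact support of a sum or multiple is never computed.\<close>
  have closed: "(\<lambda>s\<in>S. h s) \<in> carrier (free_space K S)"
    if "\<And>s. s \<in> S \<Longrightarrow> h s \<in> carrier K" "finite A" "\<And>s. s \<in> S \<Longrightarrow> s \<notin> A \<Longrightarrow> h s = \<zero>\<^bsub>K\<^esub>" for h A
    using that by (auto simp: free_space_def intro: finite_subset[of _ A])
  have add: "f \<oplus>\<^bsub>free_space K S\<^esub> g \<in> carrier (free_space K S)"
    if "f \<in> carrier (free_space K S)" "g \<in> carrier (free_space K S)" for f g
    using closed[of "\<lambda>s. f s \<oplus>\<^bsub>K\<^esub> g s" "{s \<in> S. f s \<noteq> \<zero>\<^bsub>K\<^esub>} \<union> {s \<in> S. g s \<noteq> \<zero>\<^bsub>K\<^esub>}"]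
      cl[OF that(1)] cl[OF that(2)] fin[OF that(1)] fin[OF that(2)]
    by (simp add: free_space_def)
  have smult: "a \<odot>\<^bsub>free_space K S\<^esub> f \<in> carrier (free_space K S)"
    if "a \<in> carrier K" "f \<in> carrier (free_space K S)" for a f
    using closed[of "\<lambda>s. a \<otimes>\<^bsub>K\<^esub> f s" "{s \<in> S. f s \<noteq> \<zero>\<^bsub>K\<^esub>}"] cl[OF that(2)] fin[OF that(2)] that(1)
    by (simp add: free_space_def)
  have zero: "\<zero>\<^bsub>free_space K S\<^esub> \<in> carrier (free_space K S)"
    using closed[of "\<lambda>_. \<zero>\<^bsub>K\<^esub>" "{}"] by (simp add: free_space_def)
  have app: "(f \<oplus>\<^bsub>free_space K S\<^esub> g) s = f s \<oplus>\<^bsub>K\<^esub> g s" "(a \<odot>\<^bsub>free_space K S\<^esub> f) s = a \<otimes>\<^bsub>K\<^esub> f s"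
    "\<zero>\<^bsub>free_space K S\<^esub> s = \<zero>\<^bsub>K\<^esub>" if "s \<in> S" for f g a s
    using that by (auto simp: free_space_def)
  show ?thesis
  proof (intro moduleI abelian_groupI)
    \<comment> \<open>The additive inverse of \<open>f\<close> is taken to be its multiple by minus
      one.\<close>
    fix f assume f: "f \<in> carrier (free_space K S)"
    have "(\<ominus>\<^bsub>K\<^esub> \<one>\<^bsub>K\<^esub>) \<odot>\<^bsub>free_space K S\<^esub> f \<oplus>\<^bsub>free_space K S\<^esub> f = \<zero>\<^bsub>free_space K S\<^esub>"
      using f by (intro ext add smult zero) (auto simp: app cl K.l_minus K.l_neg)
    then show "\<exists>g\<in>carrier (free_space K S). g \<oplus>\<^bsub>free_space K S\<^esub> f = \<zero>\<^bsub>free_space K S\<^esub>"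
      using smult[OF _ f, of "\<ominus>\<^bsub>K\<^esub> \<one>\<^bsub>K\<^esub>"] by auto
    show "\<one>\<^bsub>K\<^esub> \<odot>\<^bsub>free_space K S\<^esub> f = f"
      using f by (intro ext smult) (auto simp: app cl)
  next
    fix a b f assume "a \<in> carrier K" "b \<in> carrier K" "f \<in> carrier (free_space K S)"
    then show "(a \<oplus>\<^bsub>K\<^esub> b) \<odot>\<^bsub>free_space K S\<^esub> f
        = a \<odot>\<^bsub>free_space K S\<^esub> f \<oplus>\<^bsub>free_space K S\<^esub> b \<odot>\<^bsub>free_space K S\<^esub> f"
      "(a \<otimes>\<^bsub>K\<^esub> b) \<odot>\<^bsub>free_space K S\<^esub> f = a \<odot>\<^bsub>free_space K S\<^esub> (b \<odot>\<^bsub>free_space K S\<^esub> f)"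
      by (auto intro!: ext[OF smult] add smult simp: app cl K.l_distr K.m_assoc)
  next
    fix a f g assume "a \<in> carrier K" "f \<in> carrier (free_space K S)" "g \<in> carrier (free_space K S)"
    then show "a \<odot>\<^bsub>free_space K S\<^esub> (f \<oplus>\<^bsub>free_space K S\<^esub> g)
        = a \<odot>\<^bsub>free_space K S\<^esub> f \<oplus>\<^bsub>free_space K S\<^esub> a \<odot>\<^bsub>free_space K S\<^esub> g"
      by (auto intro!: ext[OF smult] add smult simp: app cl K.r_distr)
  next
    fix f g h assume "f \<in> carrier (free_space K S)" "g \<in> carrier (free_space K S)" "h \<in> carrier (free_space K S)"
    then show "f \<oplus>\<^bsub>free_space K S\<^esub> g \<oplus>\<^bsub>free_space K S\<^esub> h = f \<oplus>\<^bsub>free_space K S\<^esub> (g \<oplus>\<^bsub>free_space K S\<^esub> h)"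
      by (auto intro!: ext[OF add] add simp: app cl K.a_assoc)
  next
    fix f g assume "f \<in> carrier (free_space K S)" "g \<in> carrier (free_space K S)"
    then show "f \<oplus>\<^bsub>free_space K S\<^esub> g = g \<oplus>\<^bsub>free_space K S\<^esub> f"
      by (auto intro!: ext[OF add] add simp: app cl K.a_comm)
  next
    fix f assume "f \<in> carrier (free_space K S)"
    then show "\<zero>\<^bsub>free_space K S\<^esub> \<oplus>\<^bsub>free_space K S\<^esub> f = f"
      by (auto intro!: ext[OF add] zero simp: app cl)
  qed (fact assms | fact add | fact smult | fact zero)+
qed

lemma free_gen_closed:
  assumes "cring K"
  shows "free_gen K S s \<in> carrier (free_space K S)"
proof -
  interpret K: cring K by fact
  show ?thesis
    by (auto simp: free_gen_def free_space_def intro: finite_subset[of _ "{s}"])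
qed

text \<open>A finitely supported function is a finite combination of generators; the induction
  removes one point of a finite set containing the support.\<close>

lemma free_space_span:
  fixes K :: "('k, 'r) ring_scheme"
  assumes "cring K" "submodule E K (free_space K S)" "\<And>s. s \<in> S \<Longrightarrow> free_gen K S s \<in> E"
  shows "carrier (free_space K S) \<subseteq> E"
proof
  interpret K: cring K by fact
  interpret F: module K "free_space K S" by (rule module_free_space[OF assms(1)])
  \<comment> \<open>A subspace is nonempty and closed under negation and addition, so it contains
    some \<open>x - x\<close>.\<close>
  have E: "\<zero>\<^bsub>free_space K S\<^esub> \<in> E"
    using F.submoduleE(2,3,5)[OF assms(2)] F.submoduleE(1)[OF assms(2)] F.r_neg
    by (metis all_not_in_conv subsetD)
  \<comment> \<open>The induction runs over a finite set containing the support, because erasing a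
    value need not shrink the support itself.\<close>
  have *: "f \<in> E" if "finite A" "A \<subseteq> S" "f \<in> carrier (free_space K S)" "\<And>s. s \<in> S - A \<Longrightarrow> f s = \<zero>\<^bsub>K\<^esub>" for A f
    using that
  proof (induction A arbitrary: f rule: finite_induct)
    case empty
    then have "f = \<zero>\<^bsub>free_space K S\<^esub>"
      by (auto simp: free_space_def PiE_iff intro!: extensionalityI)
    then show ?case using E by simp
  next
    case (insert a A)
    \<comment> \<open>\<open>g\<close> is \<open>f\<close> with its value at \<open>a\<close>
      erased: it vanishes off \<open>A\<close>, and \<open>f\<close> is recovered by adding
      \<open>f a\<close> times the generator at \<open>a\<close>.\<close>
    define g where "g = (\<lambda>s\<in>S. if s = a then \<zero>\<^bsub>K\<^esub> else f s)"
    have f: "f s \<in> carrier K" if "s \<in> S" for s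
      using insert.prems(2) that by (auto simp: free_space_def)
    have "g \<in> carrier (free_space K S)"
      using insert.prems(2) f insert.hyps
      by (auto simp: free_space_def g_def intro: finite_subset[of _ "{s \<in> S. f s \<noteq> \<zero>\<^bsub>K\<^esub>}"])
    moreover have "g s = \<zero>\<^bsub>K\<^esub>" if "s \<in> S - A" for s
      using insert.prems that by (auto simp: g_def)
    ultimately have "g \<in> E"
      using insert.prems by (intro insert.IH) auto
    moreover have "f a \<odot>\<^bsub>free_space K S\<^esub> free_gen K S a \<in> E"
      using F.submoduleE(4)[OF assms(2)] assms(3) f insert.prems by auto
    moreover have "f = g \<oplus>\<^bsub>free_space K S\<^esub> (f a \<odot>\<^bsub>free_space K S\<^esub> free_gen K S a)"
      using insert.prems f
      by (auto simp: free_space_def g_def free_gen_def PiE_iff intro!: extensionalityI[of _ S])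
    ultimately show ?case using F.submoduleE(5)[OF assms(2)] by metis
  qed
  show "f \<in> E" if "f \<in> carrier (free_space K S)" for f
    using that by (intro *[of "{s \<in> S. f s \<noteq> \<zero>\<^bsub>K\<^esub>}"]) (auto simp: free_space_def)
qed

lemma free_space_lift:
  fixes K :: "('k, 'r) ring_scheme"
  assumes "module K X" "B \<in> S \<rightarrow> carrier X"
  obtains \<phi> where "linear_map K (free_space K S) X \<phi>" "\<And>s. s \<in> S \<Longrightarrow> \<phi> (free_gen K S s) = B s"
proof
  interpret X: module K X by fact
  interpret F: module K "free_space K S" by (rule module_free_space[OF X.R.is_cring])
  define supp where "supp f = {s \<in> S. f s \<noteq> \<zero>\<^bsub>K\<^esub>}" for f
  \<comment> \<open>This formula is forced by linearity and the prescribed values on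
    generators.\<close>
  define \<phi> where "\<phi> f = (\<Oplus>\<^bsub>X\<^esub>s\<in>supp f. f s \<odot>\<^bsub>X\<^esub> B s)" for f
  have f: "f s \<in> carrier K" if "f \<in> carrier (free_space K S)" "s \<in> S" for f s
    using that by (auto simp: free_space_def)
  have fin: "finite (supp f)" if "f \<in> carrier (free_space K S)" for f
    using that by (auto simp: free_space_def supp_def)
  have cl: "(\<lambda>s. f s \<odot>\<^bsub>X\<^esub> B s) \<in> A \<rightarrow> carrier X" if "f \<in> carrier (free_space K S)" "A \<subseteq> S" for f A
    using f[OF that(1)] that(2) assms(2) by auto
  \<comment> \<open>Enlarging the index set adds only zero terms. This gives \<open>g\<close>,
    \<open>h\<close> and their sum a common index set even when values cancel.\<close>
  have \<phi>: "\<phi> f = (\<Oplus>\<^bsub>X\<^esub>s\<in>A. f s \<odot>\<^bsub>X\<^esub> B s)"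
    if "f \<in> carrier (free_space K S)" "finite A" "supp f \<subseteq> A" "A \<subseteq> S" for f A
    unfolding \<phi>_def
    using that cl[OF that(1,4)] assms(2)
    by (intro X.add.finprod_mono_neutral_cong_left) (auto simp: supp_def Pi_iff subset_iff)
  show "linear_map K (free_space K S) X \<phi>"
  proof (rule linear_mapI)
    fix g assume "g \<in> carrier (free_space K S)"
    then show "\<phi> g \<in> carrier X"
      using cl unfolding \<phi>_def by (intro X.finsum_closed) (auto simp: supp_def)
  next
    fix g h assume gh: "g \<in> carrier (free_space K S)" "h \<in> carrier (free_space K S)"
    let ?A = "supp g \<union> supp h"
    have A: "finite ?A" "?A \<subseteq> S" "supp (g \<oplus>\<^bsub>free_space K S\<^esub> h) \<subseteq> ?A"
      using fin gh by (auto simp: supp_def free_space_def)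
    have "\<phi> (g \<oplus>\<^bsub>free_space K S\<^esub> h) = (\<Oplus>\<^bsub>X\<^esub>s\<in>?A. (g \<oplus>\<^bsub>free_space K S\<^esub> h) s \<odot>\<^bsub>X\<^esub> B s)"
      using gh A by (intro \<phi>) auto
    also have "\<dots> = (\<Oplus>\<^bsub>X\<^esub>s\<in>?A. g s \<odot>\<^bsub>X\<^esub> B s \<oplus>\<^bsub>X\<^esub> h s \<odot>\<^bsub>X\<^esub> B s)"
      using gh A(2) f assms(2)
      by (intro X.finsum_cong') (auto simp: free_space_def X.smult_l_distr subset_iff Pi_iff)
    also have "\<dots> = \<phi> g \<oplus>\<^bsub>X\<^esub> \<phi> h"
      using gh A cl by (simp add: \<phi>[of _ ?A] X.finsum_addf)
    finally show "\<phi> (g \<oplus>\<^bsub>free_space K S\<^esub> h) = \<phi> g \<oplus>\<^bsub>X\<^esub> \<phi> h" .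
  next
    fix a g assume a: "a \<in> carrier K" and g: "g \<in> carrier (free_space K S)"
    have A: "finite (supp g)" "supp g \<subseteq> S" "supp (a \<odot>\<^bsub>free_space K S\<^esub> g) \<subseteq> supp g"
      using fin g a by (auto simp: supp_def free_space_def)
    have "\<phi> (a \<odot>\<^bsub>free_space K S\<^esub> g) = (\<Oplus>\<^bsub>X\<^esub>s\<in>supp g. (a \<odot>\<^bsub>free_space K S\<^esub> g) s \<odot>\<^bsub>X\<^esub> B s)"
      using a g A by (intro \<phi>) auto
    also have "\<dots> = (\<Oplus>\<^bsub>X\<^esub>s\<in>supp g. a \<odot>\<^bsub>X\<^esub> (g s \<odot>\<^bsub>X\<^esub> B s))"
      using a g A(2) f assms(2)
      by (intro X.finsum_cong') (auto simp: free_space_def X.smult_assoc1 subset_iff Pi_iff)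
    also have "\<dots> = a \<odot>\<^bsub>X\<^esub> \<phi> g"
      using X.finsum_smult_ldistr[OF A(1) a cl[OF g A(2)]] by (simp add: \<phi>_def)
    finally show "\<phi> (a \<odot>\<^bsub>free_space K S\<^esub> g) = a \<odot>\<^bsub>X\<^esub> \<phi> g" .
  qed
  show "\<phi> (free_gen K S s) = B s" if "s \<in> S" for s
  proof -
    \<comment> \<open>Only containment of the support in \<open>{s}\<close> is claimed: over the
      zero ring the support of a generator is empty.\<close>
    have "\<phi> (free_gen K S s) = (\<Oplus>\<^bsub>X\<^esub>s'\<in>{s}. free_gen K S s s' \<odot>\<^bsub>X\<^esub> B s')"
      using that by (intro \<phi> free_gen_closed X.R.is_cring) (auto simp: supp_def free_gen_def)
    then show ?thesis using that assms(2) by (auto simp: free_gen_def Pi_iff)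
  qed
qed

section \<open>Linear spans as intersections of subspaces\<close>

lemma submodule_vspan:
  assumes "module K V" "A \<subseteq> carrier V"
  shows "submodule (vspan K V A) K V"
proof -
  interpret V: module K V by fact
  show ?thesis
  proof (rule V.submoduleI)
    show "vspan K V A \<subseteq> carrier V"
      \<comment> \<open>The whole space is one of the subspaces being intersected, which bounds the
        intersection.\<close>
      using V.carrier_is_submodule assms(2) by (auto simp: vspan_def)
    show "\<zero>\<^bsub>V\<^esub> \<in> vspan K V A"
      using submodule_abelian_subgroup[OF assms(1)]
      by (auto simp: vspan_def abelian_subgroup_def additive_subgroup.zero_closed)
  qed (auto simp: vspan_def dest: V.submoduleE(3-5))
qed

lemma vspan_least: "submodule N K V \<Longrightarrow> A \<subseteq> N \<Longrightarrow> vspan K V A \<subseteq> N"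
  by (auto simp: vspan_def)

section \<open>Tensor products: pure tensors, lifts of bilinear maps, composition\<close>

context
  fixes K :: "('k, 'r) ring_scheme" and V :: "('k, 'v, 'm) module_scheme" and W :: "('k, 'w, 'n) module_scheme"
  assumes V: "module K V" and W: "module K W"
begin

private abbreviation "F \<equiv> free_space K (carrier V \<times> carrier W)"
private abbreviation "gen \<equiv> free_gen K (carrier V \<times> carrier W)"

interpretation V: module K V by (rule V)
interpretation W: module K W by (rule W)
interpretation F: module K F by (rule module_free_space[OF V.R.is_cring])

private lemma gen_closed: "gen s \<in> carrier F"
  by (rule free_gen_closed[OF V.R.is_cring])

private lemma submodule_tensor_null: "submodule (tensor_null K V W) K F"
proof -
  have "tensor_relations K V W \<subseteq> carrier F"
    unfolding tensor_relations_def Let_def by (auto simp: gen_closed)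
  then show ?thesis unfolding tensor_null_def by (intro submodule_vspan F.module_axioms)
qed

private lemma linear_map_tensor_projection: "linear_map K F (tensor K V W) (\<lambda>z. tensor_null K V W +>\<^bsub>F\<^esub> z)"
  using linear_map_projection[OF F.module_axioms submodule_tensor_null F.carrier_is_submodule]
  by (simp add: tensor_def)

text \<open>Pure tensors generate: pulled back to the free module, the locus where \<open>f\<close>
  and \<open>g\<close> agree is a kernel containing every generator.\<close>

lemma tensor_ext:
  assumes "module K X" "linear_map K (tensor K V W) X f" "linear_map K (tensor K V W) X g"
    and eq: "\<And>x y. x \<in> carrier V \<Longrightarrow> y \<in> carrier W \<Longrightarrow> f (pure_tensor K V W x y) = g (pure_tensor K V W x y)"
    and t: "t \<in> carrier (tensor K V W)"
  shows "f t = g t"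
proof -
  interpret X: module K X by fact
  define \<pi> where "\<pi> z = tensor_null K V W +>\<^bsub>F\<^esub> z" for z
  have \<pi>: "linear_map K F (tensor K V W) \<pi>" unfolding \<pi>_def by (rule linear_map_tensor_projection)
  \<comment> \<open>The difference of the two pullbacks, so that agreement becomes membership in the
    kernel of a single linear map.\<close>
  define h where "h z = f (\<pi> z) \<oplus>\<^bsub>X\<^esub> \<ominus>\<^bsub>X\<^esub> g (\<pi> z)" for z
  have h: "linear_map K F X h"
    unfolding h_def using assms \<pi> by (intro linear_map_plus linear_map_uminus linear_map_compose[OF \<pi>])
  have cl: "f (\<pi> z) \<in> carrier X" "g (\<pi> z) \<in> carrier X" if "z \<in> carrier F" for z
    using that assms linear_map_closed \<pi> by metis+
  have "carrier F \<subseteq> {z \<in> carrier F. h z = \<zero>\<^bsub>X\<^esub>}"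
  proof (rule free_space_span[OF V.R.is_cring submodule_kernel[OF F.module_axioms assms(1) h]])
    fix s assume s: "s \<in> carrier V \<times> carrier W"
    then obtain x y where xy: "s = (x, y)" "x \<in> carrier V" "y \<in> carrier W" by auto
    then show "gen s \<in> {z \<in> carrier F. h z = \<zero>\<^bsub>X\<^esub>}"
      using eq[OF xy(2,3)] cl[of "gen s"] gen_closed[of s]
      by (auto simp: h_def \<pi>_def pure_tensor_def X.r_neg)
  qed
  moreover obtain z where z: "z \<in> carrier F" "t = \<pi> z"
    using t quotient_space_carrier[where V = F and Z = "carrier F"] by (auto simp: tensor_def \<pi>_def)
  ultimately have "f (\<pi> z) \<oplus>\<^bsub>X\<^esub> \<ominus>\<^bsub>X\<^esub> g (\<pi> z) = \<zero>\<^bsub>X\<^esub>" by (auto simp: h_def)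
  then show ?thesis using cl[OF z(1)] z(2) using X.minus_eq_zero_iff by (simp add: a_minus_def)
qed

text \<open>This makes the description in \<open>tensor_lift\<close> meaningful. \<open>B\<close> is
  extended to the free module and descends because bilinearity kills the relations; uniqueness is
  \<open>tensor_ext\<close>.\<close>

lemma tensor_lift_unique_existence:
  assumes X: "module K X" and B: "bilinear_map K V W X B"
  shows "\<exists>!f. f \<in> extensional (carrier (tensor K V W)) \<and> linear_map K (tensor K V W) X f \<and>
       (\<forall>x\<in>carrier V. \<forall>y\<in>carrier W. f (pure_tensor K V W x y) = B x y)"
proof -
  interpret X: module K X by fact
  have Bc: "B x y \<in> carrier X" if "x \<in> carrier V" "y \<in> carrier W" for x y
    using B that linear_map_closed by (fastforce simp: bilinear_map_def)
  have B_left: "linear_map K V X (\<lambda>x. B x y)" if "y \<in> carrier W" for y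
    using B that by (simp add: bilinear_map_def)
  have B_right: "linear_map K W X (B x)" if "x \<in> carrier V" for x
    using B that by (simp add: bilinear_map_def)
  note B_simps = linear_map_add[OF B_left] linear_map_smult[OF B_left]
    linear_map_add[OF B_right] linear_map_smult[OF B_right]
  obtain \<phi> where \<phi>: "linear_map K F X \<phi>"
    and "\<And>s. s \<in> carrier V \<times> carrier W \<Longrightarrow> \<phi> (gen s) = case_prod B s"
    by (rule free_space_lift[OF X, of "case_prod B" "carrier V \<times> carrier W"]) (use Bc in auto)
  then have \<phi>_gen: "\<phi> (gen (x, y)) = B x y" if "x \<in> carrier V" "y \<in> carrier W" for x y
    using that by auto
  note \<phi>_simps = linear_map_minus[OF F.module_axioms X \<phi>] linear_map_add[OF \<phi>] linear_map_smult[OF \<phi>]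
  \<comment> \<open>Each of the four families of relations expresses additivity or homogeneity of
    \<open>B\<close> in one argument.\<close>
  have "tensor_relations K V W \<subseteq> {z \<in> carrier F. \<phi> z = \<zero>\<^bsub>X\<^esub>}"
    unfolding tensor_relations_def Let_def
    by (auto simp: gen_closed \<phi>_simps \<phi>_gen B_simps Bc X.minus_eq_zero_iff)
  then have null: "tensor_null K V W \<subseteq> {z \<in> carrier F. \<phi> z = \<zero>\<^bsub>X\<^esub>}"
    unfolding tensor_null_def by (intro vspan_least submodule_kernel F.module_axioms X \<phi>)
  have "\<phi> z = \<phi> w" if "z \<in> carrier F" "w \<in> carrier F" "z \<ominus>\<^bsub>F\<^esub> w \<in> tensor_null K V W" for z w
    using that null \<phi>_simps(1)[of z w] linear_map_closed[OF \<phi>] X.M.minus_eq_zero_iff[of "\<phi> z" "\<phi> w"] by auto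
  \<comment> \<open>Here \<open>Z\<close> is the whole free module and \<open>N\<close> the span of
    the relations.\<close>
  from quotient_space_lift[where X = X and \<phi> = \<phi>,
      OF F.module_axioms submodule_tensor_null F.carrier_is_submodule _ this] \<phi>
  obtain f where f: "f \<in> extensional (carrier (tensor K V W))" "linear_map K (tensor K V W) X f"
    "\<And>z. z \<in> carrier F \<Longrightarrow> f (tensor_null K V W +>\<^bsub>F\<^esub> z) = \<phi> z"
    by (auto simp: tensor_def)
  show ?thesis
  proof (rule ex1I[of _ f])
    show "f \<in> extensional (carrier (tensor K V W)) \<and> linear_map K (tensor K V W) X f \<and>
       (\<forall>x\<in>carrier V. \<forall>y\<in>carrier W. f (pure_tensor K V W x y) = B x y)"
      using f gen_closed by (auto simp: pure_tensor_def \<phi>_gen)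
    then show "g = f" if "g \<in> extensional (carrier (tensor K V W)) \<and> linear_map K (tensor K V W) X g \<and>
       (\<forall>x\<in>carrier V. \<forall>y\<in>carrier W. g (pure_tensor K V W x y) = B x y)" for g
      using that tensor_ext[OF X, of g f] by (auto intro: extensionalityI[of _ "carrier (tensor K V W)"])
  qed
qed

lemma
  assumes "module K X" "bilinear_map K V W X B"
  shows linear_map_tensor_lift: "linear_map K (tensor K V W) X (tensor_lift K V W X B)"
    and tensor_lift_pure_tensor: "\<And>x y. x \<in> carrier V \<Longrightarrow> y \<in> carrier W \<Longrightarrow>
      tensor_lift K V W X B (pure_tensor K V W x y) = B x y"
  using theI'[OF tensor_lift_unique_existence[OF assms], folded tensor_lift_def] by simp_all

text \<open>This is the rule for pulling a linear map \<open>g\<close> out of a Sweedler sum: both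
  sides are linear in \<open>t\<close> and agree on pure tensors. Agreement of \<open>B'\<close>
  with \<open>g\<close> after \<open>B\<close> is asked only on the carriers, since outside them the
  integrands are arbitrary.\<close>

lemma tensor_lift_compose:
  assumes "module K X" "module K Y" "bilinear_map K V W X B" "linear_map K X Y g"
    and B': "\<And>x y. x \<in> carrier V \<Longrightarrow> y \<in> carrier W \<Longrightarrow> B' x y = g (B x y)"
    and t: "t \<in> carrier (tensor K V W)"
  shows "tensor_lift K V W Y B' t = g (tensor_lift K V W X B t)"
proof -
  have B': "bilinear_map K V W Y B'"
    using assms(3,4) B' by (auto simp: bilinear_map_def linear_map_def Pi_iff)
  show ?thesis
  proof (rule tensor_ext[OF assms(2) _ _ _ t])
    show "linear_map K (tensor K V W) Y (tensor_lift K V W Y B')"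
      by (rule linear_map_tensor_lift[OF assms(2) B'])
    show "linear_map K (tensor K V W) Y (\<lambda>t. g (tensor_lift K V W X B t))"
      by (rule linear_map_compose[OF linear_map_tensor_lift[OF assms(1,3)] assms(4)])
  qed (simp add: tensor_lift_pure_tensor assms B')
qed

end

section \<open>Functoriality of cyclic homology\<close>

lemma module_tot_space:
  fixes K :: "('k, 'r) ring_scheme" and X :: "('k, 'l) cyclic_module"
  assumes "cring K" "\<And>n. module K (cy_space X n)"
  shows "module K (tot_space X n)"
proof -
  let ?T = "tot_space X n"
  interpret K: cring K by fact
  interpret X: module K "cy_space X q" for q by fact
  have cl: "f p \<in> carrier (cy_space X (n - p))" if "f \<in> carrier ?T" "p \<le> n" for f p
    using that by (auto simp: tot_space_def)
  \<comment> \<open>As for free modules, elements are extensional, so the axioms are checked in each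
    coordinate \<open>p \<le> n\<close>.\<close>
  have ext: "f = g" if "f \<in> carrier ?T" "g \<in> carrier ?T" "\<And>p. p \<le> n \<Longrightarrow> f p = g p" for f g
    using that by (auto simp: tot_space_def intro: PiE_ext)
  have add: "f \<oplus>\<^bsub>?T\<^esub> g \<in> carrier ?T" if "f \<in> carrier ?T" "g \<in> carrier ?T" for f g
    using that by (auto simp: tot_space_def)
  have smult: "a \<odot>\<^bsub>?T\<^esub> f \<in> carrier ?T" if "a \<in> carrier K" "f \<in> carrier ?T" for a f
    using that by (auto simp: tot_space_def)
  have zero: "\<zero>\<^bsub>?T\<^esub> \<in> carrier ?T"
    by (auto simp: tot_space_def)
  have app: "(f \<oplus>\<^bsub>?T\<^esub> g) p = f p \<oplus>\<^bsub>cy_space X (n - p)\<^esub> g p"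
    "(a \<odot>\<^bsub>?T\<^esub> f) p = a \<odot>\<^bsub>cy_space X (n - p)\<^esub> f p"
    "\<zero>\<^bsub>?T\<^esub> p = \<zero>\<^bsub>cy_space X (n - p)\<^esub>" if "p \<le> n" for f g a p
    using that by (auto simp: tot_space_def)
  show ?thesis
  proof (intro moduleI abelian_groupI)
    fix f assume f: "f \<in> carrier ?T"
    have "(\<ominus>\<^bsub>K\<^esub> \<one>\<^bsub>K\<^esub>) \<odot>\<^bsub>?T\<^esub> f \<oplus>\<^bsub>?T\<^esub> f = \<zero>\<^bsub>?T\<^esub>"
      using f by (intro ext add smult zero) (auto simp: app cl X.smult_l_minus X.l_neg)
    then show "\<exists>g\<in>carrier ?T. g \<oplus>\<^bsub>?T\<^esub> f = \<zero>\<^bsub>?T\<^esub>"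
      using smult[OF _ f, of "\<ominus>\<^bsub>K\<^esub> \<one>\<^bsub>K\<^esub>"] by auto
    show "\<one>\<^bsub>K\<^esub> \<odot>\<^bsub>?T\<^esub> f = f"
      using f by (intro ext smult) (auto simp: app cl)
  next
    fix a b f assume "a \<in> carrier K" "b \<in> carrier K" "f \<in> carrier ?T"
    then show "(a \<oplus>\<^bsub>K\<^esub> b) \<odot>\<^bsub>?T\<^esub> f = a \<odot>\<^bsub>?T\<^esub> f \<oplus>\<^bsub>?T\<^esub> b \<odot>\<^bsub>?T\<^esub> f"
      "(a \<otimes>\<^bsub>K\<^esub> b) \<odot>\<^bsub>?T\<^esub> f = a \<odot>\<^bsub>?T\<^esub> (b \<odot>\<^bsub>?T\<^esub> f)"
      by (auto intro!: ext[OF smult] add smult simp: app cl X.smult_l_distr X.smult_assoc1)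
  next
    fix a f g assume "a \<in> carrier K" "f \<in> carrier ?T" "g \<in> carrier ?T"
    then show "a \<odot>\<^bsub>?T\<^esub> (f \<oplus>\<^bsub>?T\<^esub> g) = a \<odot>\<^bsub>?T\<^esub> f \<oplus>\<^bsub>?T\<^esub> a \<odot>\<^bsub>?T\<^esub> g"
      by (auto intro!: ext[OF smult] add smult simp: app cl X.smult_r_distr)
  next
    fix f g h assume "f \<in> carrier ?T" "g \<in> carrier ?T" "h \<in> carrier ?T"
    then show "f \<oplus>\<^bsub>?T\<^esub> g \<oplus>\<^bsub>?T\<^esub> h = f \<oplus>\<^bsub>?T\<^esub> (g \<oplus>\<^bsub>?T\<^esub> h)"
      by (auto intro!: ext[OF add] add simp: app cl X.a_assoc)
  next
    fix f g assume "f \<in> carrier ?T" "g \<in> carrier ?T"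
    then show "f \<oplus>\<^bsub>?T\<^esub> g = g \<oplus>\<^bsub>?T\<^esub> f"
      by (auto intro!: ext[OF add] add simp: app cl X.a_comm)
  next
    fix f assume "f \<in> carrier ?T"
    then show "\<zero>\<^bsub>?T\<^esub> \<oplus>\<^bsub>?T\<^esub> f = f"
      by (auto intro!: ext[OF add] zero simp: app cl)
  qed (fact assms | fact add | fact smult | fact zero)+
qed

lemma linear_map_tot_space_component:
  "p \<le> n \<Longrightarrow> linear_map K (tot_space X n) (cy_space X (n - p)) (\<lambda>z. z p)"
  by (auto simp: linear_map_def tot_space_def)

text \<open>With the coordinate maps above, this is the product property of \<open>Tot\<close>:
  linearity of a map into it is a question about each column.\<close>

lemma linear_map_into_tot_space:
  assumes "\<And>p. p \<le> n \<Longrightarrow> linear_map K V (cy_space X (n - p)) (g p)"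
  shows "linear_map K V (tot_space X n) (\<lambda>z. \<lambda>p\<in>{..n}. g p z)"
  using assms by (auto simp: linear_map_def tot_space_def PiE_iff Pi_iff intro!: restrict_ext)

lemma linear_map_signed:
  assumes "module K W" "linear_map K V W f"
  shows "linear_map K V W (\<lambda>x. signed W i (f x))"
  using assms by (cases "even i") (simp_all add: signed_def linear_map_uminus)

lemma signed_closed: "module K V \<Longrightarrow> x \<in> carrier V \<Longrightarrow> signed V i x \<in> carrier V"
  using linear_map_closed[OF linear_map_signed[OF _ linear_map_id]] .

lemma linear_map_signed_commute:
  assumes "module K V" "module K W" "linear_map K V W f" "x \<in> carrier V"
  shows "f (signed V i x) = signed W i (f x)"
  using linear_map_a_inv[OF assms] by (simp add: signed_def)

text \<open>The linearity that turns \<open>Tot\<close> into a sequence of vector spaces with linear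
  differentials. Faces are taken out of positive degrees, since \<open>n - 1\<close> truncates at
  \<open>n = 0\<close>.\<close>

locale linear_cyclic_operators = K?: cring K
  for K :: "('k, 'r) ring_scheme" and X :: "('k, 'l) cyclic_module" +
  assumes cy_space_module: "module K (cy_space X n)"
    and face_linear: "\<lbrakk>1 \<le> n; i \<le> n\<rbrakk> \<Longrightarrow> linear_map K (cy_space X n) (cy_space X (n - 1)) (face X n i)"
    and cyc_linear: "linear_map K (cy_space X n) (cy_space X n) (cyc X n)"
begin

section \<open>Linear differentials; cycles and boundaries as subspaces\<close>

lemma tot_space_module: "module K (tot_space X n)"
  by (rule module_tot_space[OF K.is_cring cy_space_module])

lemma cyc_signed_linear: "linear_map K (cy_space X n) (cy_space X n) (cyc_signed X n)"
  unfolding cyc_signed_def by (rule linear_map_signed[OF cy_space_module cyc_linear])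

lemma cyc_signed_power_linear: "linear_map K (cy_space X n) (cy_space X n) (\<lambda>x. (cyc_signed X n ^^ i) x)"
  by (induction i) (simp_all add: linear_map_id linear_map_compose[OF _ cyc_signed_linear])

lemma vert_diff_linear:
  assumes "1 \<le> q"
  shows "linear_map K (cy_space X q) (cy_space X (q - 1)) (vert_diff X p q)"
proof -
  have "linear_map K (cy_space X q) (cy_space X (q - 1)) (hoch_b X q)"
    "linear_map K (cy_space X q) (cy_space X (q - 1)) (hoch_b' X q)"
    unfolding hoch_b_def hoch_b'_def
    using assms by (auto intro!: linear_map_sum linear_map_signed cy_space_module face_linear simp del: One_nat_def)
  then show ?thesis
    unfolding vert_diff_def by (cases "even p") (simp_all add: linear_map_uminus[OF cy_space_module])
qed

lemma horiz_diff_linear: "linear_map K (cy_space X q) (cy_space X q) (horiz_diff X p q)"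
proof -
  have "linear_map K (cy_space X q) (cy_space X q) (cyc_norm X q)"
    unfolding cyc_norm_def
    by (intro linear_map_sum cy_space_module finite_atMost cyc_signed_power_linear)
  moreover have "linear_map K (cy_space X q) (cy_space X q) (\<lambda>x. x \<ominus>\<^bsub>cy_space X q\<^esub> cyc_signed X q x)"
    unfolding a_minus_def
    by (intro linear_map_plus linear_map_uminus linear_map_id cy_space_module cyc_signed_linear)
  ultimately show ?thesis unfolding horiz_diff_def by (cases "odd p") simp_all
qed

text \<open>For \<open>p \<le> n\<close> the vertical differential starts in degree
  \<open>Suc n - p\<close>, which is at least 1, so the truncated case never occurs.\<close>

lemma tot_diff_linear: "linear_map K (tot_space X (Suc n)) (tot_space X n) (tot_diff X n)"
  unfolding tot_diff_def
proof (intro linear_map_into_tot_space linear_map_plus cy_space_module)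
  fix p assume p: "p \<le> n"
  show "linear_map K (tot_space X (Suc n)) (cy_space X (n - p)) (\<lambda>z. vert_diff X p (Suc n - p) (z p))"
    using linear_map_compose[OF linear_map_tot_space_component[of p "Suc n"] vert_diff_linear[of "Suc n - p" p]] p
    by simp
  \<comment> \<open>Column \<open>Suc p\<close> of the source has degree
    \<open>Suc n - Suc p = n - p\<close>, the degree in which the horizontal differential
    stays.\<close>
  show "linear_map K (tot_space X (Suc n)) (cy_space X (n - p)) (\<lambda>z. horiz_diff X (Suc p) (n - p) (z (Suc p)))"
    using linear_map_compose[OF linear_map_tot_space_component[of "Suc p" "Suc n", unfolded diff_Suc_Suc]
        horiz_diff_linear[of "n - p" "Suc p"]] p
    by simp
qed

lemma cyclic_cycles_submodule: "submodule (cyclic_cycles X n) K (tot_space X n)"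
proof (cases n)
  \<comment> \<open>In degree zero all chains are cycles by definition; in higher degrees cycles are
    the kernel of the differential.\<close>
  case 0
  then show ?thesis
    using module.carrier_is_submodule[OF tot_space_module] by (simp add: cyclic_cycles_def)
next
  case (Suc m)
  then show ?thesis
    using submodule_kernel[OF tot_space_module tot_space_module tot_diff_linear]
    by (simp add: cyclic_cycles_def)
qed

lemma cyclic_boundaries_submodule: "submodule (cyclic_boundaries X n) K (tot_space X n)"
  unfolding cyclic_boundaries_def
  by (rule submodule_image[OF tot_space_module tot_space_module tot_diff_linear])

lemma cyclic_cycles_subset: "cyclic_cycles X n \<subseteq> carrier (tot_space X n)"
  by (rule module.submoduleE(1)[OF tot_space_module cyclic_cycles_submodule])

end

text \<open>The compatibilities from which all differentials of the bicomplex inherit naturality: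
  faces give \<open>b\<close> and \<open>b'\<close>, the cyclic operator gives \<lambda> and the
  norm.\<close>

locale cyclic_operators_morphism =
  X: linear_cyclic_operators K X + X': linear_cyclic_operators K X'
  for K :: "('k, 'r) ring_scheme" and X :: "('k, 'l) cyclic_module" and X' :: "('k, 'm) cyclic_module" +
  fixes f :: "nat \<Rightarrow> 'l \<Rightarrow> 'm"
  assumes linear: "linear_map K (cy_space X n) (cy_space X' n) (f n)"
    and face: "\<lbrakk>1 \<le> n; i \<le> n; x \<in> carrier (cy_space X n)\<rbrakk> \<Longrightarrow> f (n - 1) (face X n i x) = face X' n i (f n x)"
    and cyc: "x \<in> carrier (cy_space X n) \<Longrightarrow> f n (cyc X n x) = cyc X' n (f n x)"
begin

text \<open>The free index set \<open>A\<close> serves both \<open>b\<close>, with all faces, and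
  \<open>b'\<close>, which omits the last one.\<close>

lemma face_sum:
  assumes "1 \<le> n" "A \<subseteq> {..n}" "x \<in> carrier (cy_space X n)"
  shows "f (n - 1) (\<Oplus>\<^bsub>cy_space X (n - 1)\<^esub>i\<in>A. signed (cy_space X (n - 1)) i (face X n i x))
    = (\<Oplus>\<^bsub>cy_space X' (n - 1)\<^esub>i\<in>A. signed (cy_space X' (n - 1)) i (face X' n i (f n x)))"
proof -
  interpret V: module K "cy_space X (n - 1)" by (rule X.cy_space_module)
  interpret W: module K "cy_space X' (n - 1)" by (rule X'.cy_space_module)
  have A: "finite A" using assms(2) finite_subset by blast
  have c: "face X n i x \<in> carrier (cy_space X (n - 1))" if "i \<in> A" for i
    using linear_map_closed[OF X.face_linear assms(3)] assms that by auto
  have c': "face X' n i (f n x) \<in> carrier (cy_space X' (n - 1))" if "i \<in> A" for i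
    using linear_map_closed[OF X'.face_linear linear_map_closed[OF linear assms(3)]] assms that by auto
  have "f (n - 1) (\<Oplus>\<^bsub>cy_space X (n - 1)\<^esub>i\<in>A. signed (cy_space X (n - 1)) i (face X n i x))
      = (\<Oplus>\<^bsub>cy_space X' (n - 1)\<^esub>i\<in>A. f (n - 1) (signed (cy_space X (n - 1)) i (face X n i x)))"
    using c by (intro linear_map_finsum[OF V.module_axioms W.module_axioms linear A])
      (auto intro: signed_closed[OF V.module_axioms] simp del: One_nat_def)
  also have "\<dots> = (\<Oplus>\<^bsub>cy_space X' (n - 1)\<^esub>i\<in>A. signed (cy_space X' (n - 1)) i (face X' n i (f n x)))"
    using c c' assms face
    by (intro W.finsum_cong')
      (auto simp: linear_map_signed_commute[OF V.module_axioms W.module_axioms linear] subset_iff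
        simp del: One_nat_def intro: signed_closed[OF W.module_axioms])
  finally show ?thesis .
qed

lemma vert_diff:
  assumes "1 \<le> q" "x \<in> carrier (cy_space X q)"
  shows "f (q - 1) (vert_diff X p q x) = vert_diff X' p q (f q x)"
proof -
  have b': "f (q - 1) (hoch_b' X q x) = hoch_b' X' q (f q x)"
    unfolding hoch_b'_def using assms by (intro face_sum) auto
  show ?thesis
  proof (cases "even p")
    case True
    then show ?thesis unfolding vert_diff_def hoch_b_def using face_sum[OF assms(1) order_refl assms(2)] by simp
  next
    case False
    \<comment> \<open>Membership in the carrier is what lets \<open>f\<close> move past the minus
      sign of the odd columns.\<close>
    have "hoch_b' X q x \<in> carrier (cy_space X (q - 1))"
    proof -
      interpret V: module K "cy_space X (q - 1)" by (rule X.cy_space_module)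
      show ?thesis unfolding hoch_b'_def
        using linear_map_closed[OF X.face_linear assms(2)] assms(1)
        by (intro V.finsum_closed) (auto intro: signed_closed[OF V.module_axioms] simp del: One_nat_def)
    qed
    then show ?thesis
      using False b' linear_map_a_inv[OF X.cy_space_module X'.cy_space_module linear]
      by (simp add: vert_diff_def)
  qed
qed

lemma cyc_signed:
  "x \<in> carrier (cy_space X n) \<Longrightarrow> f n (cyc_signed X n x) = cyc_signed X' n (f n x)"
  unfolding cyc_signed_def
  using linear_map_signed_commute[OF X.cy_space_module X'.cy_space_module linear]
    linear_map_closed[OF X.cyc_linear] cyc by simp

lemma cyc_signed_power:
  assumes "x \<in> carrier (cy_space X n)"
  shows "f n ((cyc_signed X n ^^ i) x) = (cyc_signed X' n ^^ i) (f n x)"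
  by (induction i) (simp_all add: cyc_signed linear_map_closed[OF X.cyc_signed_power_linear assms])

lemma horiz_diff:
  assumes x: "x \<in> carrier (cy_space X q)"
  shows "f q (horiz_diff X p q x) = horiz_diff X' p q (f q x)"
proof (cases "odd p")
  case True
  then show ?thesis
    using x linear_map_minus[OF X.cy_space_module X'.cy_space_module linear x]
      linear_map_closed[OF X.cyc_signed_linear x]
    by (simp add: horiz_diff_def cyc_signed)
next
  case False
  \<comment> \<open>The norm is a finite sum of powers of the signed cyclic operator, and
    \<open>f\<close> commutes with each of them.\<close>
  have "f q (cyc_norm X q x) = cyc_norm X' q (f q x)"
    unfolding cyc_norm_def
    using linear_map_closed[OF X.cyc_signed_power_linear x]
    by (subst linear_map_finsum[OF X.cy_space_module X'.cy_space_module linear])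
      (auto simp: cyc_signed_power[OF x])
  then show ?thesis using False by (simp add: horiz_diff_def)
qed

section \<open>The induced chain map and its effect on homology\<close>

lemma tot_map_linear: "linear_map K (tot_space X n) (tot_space X' n) (tot_map f n)"
  unfolding tot_map_def
  by (intro linear_map_into_tot_space linear_map_compose[OF linear_map_tot_space_component linear])

text \<open>In column \<open>p \<le> n\<close> additivity of \<open>f\<close> combines naturality of
  the vertical differential at \<open>z p\<close> with that of the horizontal one at
  \<open>z (Suc p)\<close>.\<close>

lemma tot_map_tot_diff:
  assumes z: "z \<in> carrier (tot_space X (Suc n))"
  shows "tot_map f n (tot_diff X n z) = tot_diff X' n (tot_map f (Suc n) z)"
proof
  fix p
  show "tot_map f n (tot_diff X n z) p = tot_diff X' n (tot_map f (Suc n) z) p"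
  proof (cases "p \<le> n")
    case p: True
    have z1: "z p \<in> carrier (cy_space X (Suc n - p))" and z2: "z (Suc p) \<in> carrier (cy_space X (n - p))"
      using z p linear_map_closed[OF linear_map_tot_space_component[of p "Suc n"] z]
        linear_map_closed[OF linear_map_tot_space_component[of "Suc p" "Suc n"] z] by auto
    have q: "1 \<le> Suc n - p" "Suc n - p - 1 = n - p" using p by auto
    show ?thesis
      using p linear_map_add[OF linear, of "vert_diff X p (Suc n - p) (z p)" "n - p" "horiz_diff X (Suc p) (n - p) (z (Suc p))"]
        linear_map_closed[OF X.vert_diff_linear[OF q(1)] z1] linear_map_closed[OF X.horiz_diff_linear z2]
        vert_diff[OF q(1) z1] horiz_diff[OF z2] q(2)
      by (simp add: tot_map_def tot_diff_def)
  \<comment> \<open>Beyond column \<open>n\<close> both restricted functions take the value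
    \<open>undefined\<close>.\<close>
  qed (simp add: tot_map_def tot_diff_def)
qed

lemma tot_map_cycles:
  assumes "z \<in> cyclic_cycles X n"
  shows "tot_map f n z \<in> cyclic_cycles X' n"
proof (cases n)
  case 0
  then show ?thesis
    using assms linear_map_closed[OF tot_map_linear] by (simp add: cyclic_cycles_def)
next
  case (Suc m)
  then have z: "z \<in> carrier (tot_space X (Suc m))" "tot_diff X m z = \<zero>\<^bsub>tot_space X m\<^esub>"
    using assms by (auto simp: cyclic_cycles_def)
  then have "tot_diff X' m (tot_map f (Suc m) z) = \<zero>\<^bsub>tot_space X' m\<^esub>"
    using tot_map_tot_diff[OF z(1)] linear_map_zero[OF X.tot_space_module X'.tot_space_module tot_map_linear]
    by simp
  then show ?thesis
    using Suc linear_map_closed[OF tot_map_linear z(1)] by (simp add: cyclic_cycles_def)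
qed

lemma tot_map_boundaries:
  "z \<in> cyclic_boundaries X n \<Longrightarrow> tot_map f n z \<in> cyclic_boundaries X' n"
  unfolding cyclic_boundaries_def using tot_map_tot_diff linear_map_closed[OF tot_map_linear] by force

text \<open>The chain map preserves cycles and boundaries, so it descends by
  \<open>quotient_space_lift\<close> applied to cycles modulo boundaries.\<close>

theorem cyclic_homology_map:
  "\<exists>!F. F \<in> extensional (carrier (cyclic_homology X n)) \<and>
      linear_map K (cyclic_homology X n) (cyclic_homology X' n) F \<and>
      (\<forall>z\<in>cyclic_cycles X n. F (cyclic_class X n z) = cyclic_class X' n (tot_map f n z))"
proof -
  let ?V = "(tot_space X n)\<lparr>carrier := cyclic_cycles X n\<rparr>"
  let ?W = "(tot_space X' n)\<lparr>carrier := cyclic_cycles X' n\<rparr>"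
  have "linear_map K ?V ?W (tot_map f n)"
    using tot_map_linear[of n] X.cyclic_cycles_subset[of n] tot_map_cycles[of _ n]
    by (auto simp: linear_map_def subset_iff)
  then have "linear_map K ?V (cyclic_homology X' n) (\<lambda>z. cyclic_class X' n (tot_map f n z))"
    unfolding cyclic_homology_def cyclic_class_def
    by (rule linear_map_compose[OF _ linear_map_projection[OF X'.tot_space_module
          X'.cyclic_boundaries_submodule X'.cyclic_cycles_submodule]])
  \<comment> \<open>Homologous cycles have homologous images: the difference is a boundary, and
    linearity carries it to a boundary.\<close>
  moreover have "cyclic_class X' n (tot_map f n z) = cyclic_class X' n (tot_map f n w)"
    if "z \<in> cyclic_cycles X n" "w \<in> cyclic_cycles X n" "z \<ominus>\<^bsub>tot_space X n\<^esub> w \<in> cyclic_boundaries X n" for z w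
  proof -
    have zw: "z \<in> carrier (tot_space X n)" "w \<in> carrier (tot_space X n)"
      using that X.cyclic_cycles_subset by auto
    have "tot_map f n z \<ominus>\<^bsub>tot_space X' n\<^esub> tot_map f n w \<in> cyclic_boundaries X' n"
      using tot_map_boundaries[OF that(3)]
        linear_map_minus[OF X.tot_space_module X'.tot_space_module tot_map_linear zw] by simp
    then show ?thesis
      unfolding cyclic_class_def
      using a_r_coset_eq_iff[OF X'.tot_space_module X'.cyclic_boundaries_submodule] zw
        linear_map_closed[OF tot_map_linear] by blast
  qed
  ultimately show ?thesis
    using quotient_space_lift[where X = "cyclic_homology X' n" and \<phi> = "\<lambda>z. cyclic_class X' n (tot_map f n z)",
        OF X.tot_space_module X.cyclic_boundaries_submodule X.cyclic_cycles_submodule]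
    by (simp add: cyclic_homology_def cyclic_class_def)
qed

end

section \<open>Comodule measurings\<close>

lemma (in cyclic_unital_comp_module) linear_cyclic_operators_cyclic_module_of:
  "linear_cyclic_operators K (cyclic_module_of \<O> \<L>)"
proof (intro linear_cyclic_operators.intro linear_cyclic_operators_axioms.intro)
  show "cring K" by (rule K.is_cring)
next
  fix n i :: nat assume "1 \<le> n" "i \<le> n"
  \<comment> \<open>The bound \<open>i' < n\<close> is the range of \<open>act_bilinear\<close> for
    \<open>p = 2\<close>. It covers the faces before the last directly, and index 0 covers the last
    face after composing with \<open>t\<close>.\<close>
  have act_m: "linear_map K (cm_space \<L> n) (cm_space \<L> (n - 1)) (act \<L> 2 n i' (op_mult \<O>))" if "i' < n" for i'
    using act_bilinear[of 2 n i'] op_mult_closed that \<open>1 \<le> n\<close> by (simp add: bilinear_map_def)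
  show "linear_map K (cy_space (cyclic_module_of \<O> \<L>) n) (cy_space (cyclic_module_of \<O> \<L>) (n - 1))
      (face (cyclic_module_of \<O> \<L>) n i)"
    using act_m[of i] linear_map_compose[OF cm_cyc_linear act_m[of 0]] \<open>1 \<le> n\<close>
    by (cases "i < n") (simp_all add: cyclic_module_of_def)
qed (simp_all add: cyclic_module_of_def cm_space cm_cyc_linear)

text \<open>Here the counits enter: the measuring turns \<open>m\<close> into a multiple of
  \<open>m'\<close> by the counit, and the counit axiom of \<open>D\<close> then collapses the
  Sweedler sum.\<close>

lemma comodule_measuring_act_mult:
  assumes C: "cocommutative_coalgebra K C" and D: "left_comodule K C D"
    and \<Psi>: "operad_measuring K C \<O> \<O>' \<Psi>"
    and \<L>: "cyclic_unital_comp_module K \<O> \<L>" and \<L>': "cyclic_unital_comp_module K \<O>' \<L>'"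
    and \<Omega>: "comodule_measuring K C \<O> \<Psi> D \<L> \<L>' \<Omega>"
    and y: "y \<in> carrier D" and l: "l \<in> carrier (cm_space \<L> n)" and i: "i < n"
  shows "\<Omega> (n - 1) y (act \<L> 2 n i (op_mult \<O>) l) = act \<L>' 2 n i (op_mult \<O>') (\<Omega> n y l)"
proof -
  interpret C: cocommutative_coalgebra K C by fact
  interpret D: left_comodule K C D by fact
  interpret L: cyclic_unital_comp_module K \<O> \<L> by fact
  interpret L': cyclic_unital_comp_module K \<O>' \<L>' by fact
  interpret O2: module K "op_space \<O>' 2" by (rule L'.op_space)
  \<comment> \<open>The linear map on \<open>D\<close> that will be pulled out of the Sweedler
    sum.\<close>
  define g where "g d = act \<L>' 2 n i (op_mult \<O>') (\<Omega> n d l)" for d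
  have \<Omega>l: "linear_map K D (cm_space \<L>' n) (\<lambda>d. \<Omega> n d l)"
    using \<Omega> l by (simp add: comodule_measuring_def bilinear_map_def)
  have bil: "bilinear_map K (op_space \<O>' 2) (cm_space \<L>' n) (cm_space \<L>' (n - 1)) (act \<L>' 2 n i)"
    using L'.act_bilinear[of 2 n i] i by simp
  have act': "linear_map K (cm_space \<L>' n) (cm_space \<L>' (n - 1)) (act \<L>' 2 n i (op_mult \<O>'))"
    using bil L'.op_mult_closed by (simp add: bilinear_map_def)
  have g: "linear_map K D (cm_space \<L>' (n - 1)) g"
    unfolding g_def by (rule linear_map_compose[OF \<Omega>l act'])
  have eps: "counit C c \<in> carrier K" if "c \<in> carrier C" for c
    using linear_map_closed[OF C.counit_linear that] by (simp add: base_space_def)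
  \<comment> \<open>Bilinearity guarantees that the lift occurring in the counit axiom is the
    induced linear map on the tensor product.\<close>
  have B: "bilinear_map K C D D (\<lambda>c d. counit C c \<odot>\<^bsub>D\<^esub> d)"
    unfolding bilinear_map_def
  proof (intro conjI ballI)
    fix c assume "c \<in> carrier C"
    then show "linear_map K D D ((\<odot>\<^bsub>D\<^esub>) (counit C c))"
      using eps by (intro linear_mapI) (auto simp: D.smult_r_distr D.smult_assoc1[symmetric] C.K.m_comm)
  next
    fix d assume "d \<in> carrier D"
    then show "linear_map K C D (\<lambda>c. counit C c \<odot>\<^bsub>D\<^esub> d)"
      using eps linear_map_add[OF C.counit_linear] linear_map_smult[OF C.counit_linear]
      by (intro linear_mapI) (auto simp: base_space_def D.smult_l_distr D.smult_assoc1)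
  qed
  \<comment> \<open>The scalar \<open>counit C c\<close> leaves the operad argument of the action by
    linearity there and re-enters through the linear map \<open>g\<close>.\<close>
  have "act \<L>' 2 n i (\<Psi> 2 c (op_mult \<O>)) (\<Omega> n d l) = g (counit C c \<odot>\<^bsub>D\<^esub> d)"
    if c: "c \<in> carrier C" and d: "d \<in> carrier D" for c d
  proof -
    have "linear_map K (op_space \<O>' 2) (cm_space \<L>' (n - 1)) (\<lambda>u. act \<L>' 2 n i u (\<Omega> n d l))"
      using bil linear_map_closed[OF \<Omega>l d] by (simp add: bilinear_map_def)
    then have "act \<L>' 2 n i (counit C c \<odot>\<^bsub>op_space \<O>' 2\<^esub> op_mult \<O>') (\<Omega> n d l)
        = counit C c \<odot>\<^bsub>cm_space \<L>' (n - 1)\<^esub> g d"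
      using linear_map_smult eps[OF c] L'.op_mult_closed by (fastforce simp: g_def)
    then show ?thesis
      using \<Psi> c linear_map_smult[OF g eps[OF c] d] by (simp add: operad_measuring_def)
  qed
  then have "tensor_lift K C D (cm_space \<L>' (n - 1))
      (\<lambda>c d. act \<L>' 2 n i (\<Psi> 2 c (op_mult \<O>)) (\<Omega> n d l)) (coact D y)
    = g (tensor_lift K C D D (\<lambda>c d. counit C c \<odot>\<^bsub>D\<^esub> d) (coact D y))"
    by (rule tensor_lift_compose[OF C.C.module_axioms D.D.module_axioms D.D.module_axioms L'.cm_space B g])
      (use linear_map_closed[OF D.coact_linear y] in auto)
  \<comment> \<open>For \<open>p = 2\<close> the admissible range \<open>i + 2 \<le> n + 1\<close>
    of the measuring is exactly \<open>i < n\<close>.\<close>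
  moreover have "\<Omega> (n + 1 - 2) y (act \<L> 2 n i (op_mult \<O>) l) = tensor_lift K C D (cm_space \<L>' (n + 1 - 2))
      (\<lambda>c d. act \<L>' 2 n i (\<Psi> 2 c (op_mult \<O>)) (\<Omega> n d l)) (coact D y)"
    using \<Omega>[unfolded comodule_measuring_def, THEN conjunct2, THEN conjunct1, rule_format,
        OF y L.op_mult_closed l, of i] i by simp
  \<comment> \<open>The remaining lift is \<open>y\<close> itself by the counit axiom of the
    coaction.\<close>
  ultimately show ?thesis using D.coact_counit[OF y] by (simp add: g_def)
qed

lemma comodule_measuring_morphism:
  assumes C: "cocommutative_coalgebra K C" and D: "left_comodule K C D"
    and \<Psi>: "operad_measuring K C \<O> \<O>' \<Psi>"
    and \<L>: "cyclic_unital_comp_module K \<O> \<L>" and \<L>': "cyclic_unital_comp_module K \<O>' \<L>'"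
    and \<Omega>: "comodule_measuring K C \<O> \<Psi> D \<L> \<L>' \<Omega>"
    and y: "y \<in> carrier D"
  shows "cyclic_operators_morphism K (cyclic_module_of \<O> \<L>) (cyclic_module_of \<O>' \<L>') (\<lambda>n. \<Omega> n y)"
proof (intro cyclic_operators_morphism.intro cyclic_operators_morphism_axioms.intro
    cyclic_unital_comp_module.linear_cyclic_operators_cyclic_module_of \<L> \<L>')
  fix n
  show "linear_map K (cy_space (cyclic_module_of \<O> \<L>) n) (cy_space (cyclic_module_of \<O>' \<L>') n) (\<Omega> n y)"
    using \<Omega> y by (simp add: comodule_measuring_def bilinear_map_def cyclic_module_of_def)
next
  fix n x assume "x \<in> carrier (cy_space (cyclic_module_of \<O> \<L>) n)"
  then show "\<Omega> n y (cyc (cyclic_module_of \<O> \<L>) n x) = cyc (cyclic_module_of \<O>' \<L>') n (\<Omega> n y x)"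
    using \<Omega> y by (simp add: comodule_measuring_def cyclic_module_of_def)
next
  fix n i :: nat and x
  assume n: "1 \<le> n" "i \<le> n" and "x \<in> carrier (cy_space (cyclic_module_of \<O> \<L>) n)"
  then have x: "x \<in> carrier (cm_space \<L> n)" by (simp add: cyclic_module_of_def)
  \<comment> \<open>The last face is the action of \<open>m\<close> at index 0 on
    \<open>t x\<close>, so the preceding lemma is also applied to \<open>t x\<close>; index 0 is
    allowed because \<open>1 \<le> n\<close>.\<close>
  have tx: "cm_cyc \<L> n x \<in> carrier (cm_space \<L> n)"
    by (rule linear_map_closed[OF cyclic_unital_comp_module.cm_cyc_linear[OF \<L>] x])
  have "\<Omega> n y (cm_cyc \<L> n x) = cm_cyc \<L>' n (\<Omega> n y x)"
    using \<Omega> y x by (simp add: comodule_measuring_def)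
  then show "\<Omega> (n - 1) y (face (cyclic_module_of \<O> \<L>) n i x) = face (cyclic_module_of \<O>' \<L>') n i (\<Omega> n y x)"
    using comodule_measuring_act_mult[OF assms x, of i] comodule_measuring_act_mult[OF assms tx, of 0] n
    by (simp add: cyclic_module_of_def)
qed

text \<open>The induced morphism is the unique family with the prescribed values on homology
  classes; extensionality fixes it elsewhere. Preservation of cycles is part of the claim, so that
  the class on the right is a homology class.\<close>

theorem proposition8p8:
  fixes K :: "'k ring"
    and C :: "('k, 'c) coalgebra" and D :: "('k, 'd, 'c) comodule"
    and \<O> :: "('k, 'o) operad" and \<O>' :: "('k, 'p) operad"
    and \<L> :: "('k, 'o, 'l) comp_module" and \<L>' :: "('k, 'p, 'm) comp_module"
    and \<Psi> :: "nat \<Rightarrow> 'c \<Rightarrow> 'o \<Rightarrow> 'p" and \<Omega> :: "nat \<Rightarrow> 'd \<Rightarrow> 'l \<Rightarrow> 'm"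
  assumes "field K"
    and "cocommutative_coalgebra K C"
    and "operad_with_mult K \<O>" and "operad_with_mult K \<O>'"
    and "operad_measuring K C \<O> \<O>' \<Psi>"
    and "cyclic_unital_comp_module K \<O> \<L>" and "cyclic_unital_comp_module K \<O>' \<L>'"
    and "left_comodule K C D"
    and "comodule_measuring K C \<O> \<Psi> D \<L> \<L>' \<Omega>"
    and "y \<in> carrier D"
  shows "\<exists>!F. \<forall>n. F n \<in> extensional (carrier (HC \<O> \<L> n)) \<and>
      linear_map K (HC \<O> \<L> n) (HC \<O>' \<L>' n) (F n) \<and>
      (\<forall>z\<in>cyclic_cycles (cyclic_module_of \<O> \<L>) n.
         tot_map (\<lambda>q. \<Omega> q y) n z \<in> cyclic_cycles (cyclic_module_of \<O>' \<L>') n \<and>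
         F n (cyclic_class (cyclic_module_of \<O> \<L>) n z)
           = cyclic_class (cyclic_module_of \<O>' \<L>') n (tot_map (\<lambda>q. \<Omega> q y) n z))"
proof -
  interpret cyclic_operators_morphism K "cyclic_module_of \<O> \<L>" "cyclic_module_of \<O>' \<L>'" "\<lambda>n. \<Omega> n y"
    by (rule comodule_measuring_morphism) (fact assms)+
  let ?X = "cyclic_module_of \<O> \<L>" and ?X' = "cyclic_module_of \<O>' \<L>'"
  \<comment> \<open>Preservation of cycles holds by \<open>tot_map_cycles\<close>, which leaves the
    degreewise statement \<open>cyclic_homology_map\<close>.\<close>
  have "\<forall>n. \<exists>!G. G \<in> extensional (carrier (HC \<O> \<L> n)) \<and>
      linear_map K (HC \<O> \<L> n) (HC \<O>' \<L>' n) G \<and>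
      (\<forall>z\<in>cyclic_cycles ?X n. tot_map (\<lambda>q. \<Omega> q y) n z \<in> cyclic_cycles ?X' n \<and>
         G (cyclic_class ?X n z) = cyclic_class ?X' n (tot_map (\<lambda>q. \<Omega> q y) n z))"
    unfolding HC_def using cyclic_homology_map by (simp add: tot_map_cycles cong: ball_cong)
  \<comment> \<open>Unique existence in every degree is the same as unique existence of the whole
    family.\<close>
  then show ?thesis unfolding choice_eq .
qed

end
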